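(* Let $D\subseteq\mathbb{R}^2=\mathbb{C}$ be an open, bounded, connected and simply connected domain with smooth boundary, let $\xi\in\mathbb{R}\setminus\{0\}$, and set $\xi_1=-\frac13\xi$, $\xi_2=\xi_3=\frac23\xi$. Take $z_0\in D$. Then there exist $T>0$ and a solution $z=(z_1,z_2,z_3):(0,T)\to D^3\setminus\triangle^3$ of $$\dot{\bar z}_j=\frac1{2\pi i}\sum_{k\in\{1,2,3\},\,k\ne j}\frac{\xi_k}{z_j-z_k}-\sum_{k=1}^3\xi_k\,\overline{\nabla_x^\perp\gamma(z_j,z_k)},\qquad t\in(0,T),\quad j=1,2,3,$$ such that $\lim_{t\to0}z_j(t)=z_0$ for every $j=1,2,3$.
   Context: $\mathbb{R}^2$ is identified with $\mathbb{C}$, a bar denotes complex conjugation, and $\triangle^3$ is the set of triples having at least two equal components. $G(x,y)=-\frac1{2\pi}\log|x-y|$ is the Green function on $\mathbb{R}^2$. The function $\gamma=\gamma_D:D\times D\to\mathbb{R}$ is defined, for each $x\in D$, by letting $\gamma(x,\cdot)$ be the solution of $\Delta_y\gamma(x,y)=0$ for $y\in D$, $\gamma(x,y)=-G(x,y)$ for $y\in\partial D$; thus $G_D=G+\gamma$ is the Green function of the Laplace operator on $D$ with zero Dirichlet boundary condition, and $\gamma$ is smooth in $D\times D$. $\nabla_x^\perp\gamma(x,y)=(-\partial_{x_2}\gamma,\partial_{x_1}\gamma)(x,y)$ is the rotated gradient in the first variable, regarded as a complex number. A solution is a $C^1$ curve satisfying the equations. *)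

theory Defs
  imports "HOL-Analysis.Analysis"
begin

text \<open>
  The plane \<open>\<real>\<^sup>2\<close> is the type \<^typ>\<open>complex\<close>; the coordinate directions are \<open>1\<close> and \<open>\<i>\<close>.
\<close>

definition partial1 :: "(complex \<Rightarrow> real) \<Rightarrow> complex \<Rightarrow> real" where
  "partial1 f x = deriv (\<lambda>t. f (x + complex_of_real t)) 0"

definition partial2 :: "(complex \<Rightarrow> real) \<Rightarrow> complex \<Rightarrow> real" where
  "partial2 f x = deriv (\<lambda>t. f (x + complex_of_real t * \<i>)) 0"

text \<open>
  \<open>C_k_on n f U\<close> means that \<open>f\<close> is of class \<open>C\<^sup>n\<close> on the open set \<open>U\<close>. Requiring total
  differentiability at each stage ensures that \<^const>\<open>partial1\<close> and \<^const>\<open>partial2\<close> are never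
  evaluated where the partial derivatives fail to exist.
\<close>

fun C_k_on :: "nat \<Rightarrow> (complex \<Rightarrow> real) \<Rightarrow> complex set \<Rightarrow> bool" where
  "C_k_on 0 f U \<longleftrightarrow> continuous_on U f"
| "C_k_on (Suc n) f U \<longleftrightarrow>
     (\<forall>x\<in>U. f differentiable (at x)) \<and> C_k_on n (partial1 f) U \<and> C_k_on n (partial2 f) U"

definition laplacian :: "(complex \<Rightarrow> real) \<Rightarrow> complex \<Rightarrow> real" where
  "laplacian f x = partial1 (partial1 f) x + partial2 (partial2 f) x"

definition perp_grad :: "(complex \<Rightarrow> real) \<Rightarrow> complex \<Rightarrow> complex" where
  "perp_grad f x = Complex (- partial2 f x) (partial1 f x)"

text \<open>
  Near each boundary point the open set \<open>D\<close> is a strict sublevel set of a \<open>C\<^sup>\<infinity>\<close> function without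
  critical points. Hence the boundary is locally the regular level set \<open>\<phi> = 0\<close>, and \<open>D\<close> lies
  locally on one side of it.
\<close>

definition smooth_boundary :: "complex set \<Rightarrow> bool" where
  "smooth_boundary D \<longleftrightarrow>
     (\<forall>p\<in>frontier D. \<exists>U \<phi>. open U \<and> p \<in> U \<and> (\<forall>n. C_k_on n \<phi> U) \<and>
        (\<forall>x\<in>U. (partial1 \<phi> x, partial2 \<phi> x) \<noteq> (0, 0)) \<and>
        D \<inter> U = {x \<in> U. \<phi> x < 0})"

definition green_plane :: "complex \<Rightarrow> complex \<Rightarrow> real" where
  "green_plane x y = - (1 / (2 * pi)) * ln (norm (x - y))"

definition solves_dirichlet ::
    "complex set \<Rightarrow> (complex \<Rightarrow> real) \<Rightarrow> (complex \<Rightarrow> real) \<Rightarrow> bool" where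
  "solves_dirichlet D g h \<longleftrightarrow>
     continuous_on (closure D) h \<and> C_k_on 2 h D \<and>
     (\<forall>y\<in>D. laplacian h y = 0) \<and> (\<forall>y\<in>frontier D. h y = g y)"

text \<open>
  The function \<open>\<gamma>\<^sub>D\<close>. A solution of the Dirichlet problem is determined only on the closure
  of \<open>D\<close>, not as a function on all of \<^typ>\<open>complex\<close>, so its value at \<open>y\<close> is described rather than
  the function itself. It is meaningful for \<open>x \<in> D\<close> and \<open>y\<close> in the closure of \<open>D\<close>.
\<close>

definition gamma_dom :: "complex set \<Rightarrow> complex \<Rightarrow> complex \<Rightarrow> real" where
  "gamma_dom D x y = (THE v. \<exists>h. solves_dirichlet D (\<lambda>w. - green_plane x w) h \<and> v = h y)"

definition vortex_rhs :: "complex set \<Rightarrow> real ^ 3 \<Rightarrow> complex ^ 3 \<Rightarrow> 3 \<Rightarrow> complex" where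
  "vortex_rhs D \<xi> w j =
     1 / (2 * complex_of_real pi * \<i>) *
       (\<Sum>k \<in> UNIV - {j}. complex_of_real (\<xi> $ k) / (w $ j - w $ k))
     - (\<Sum>k \<in> UNIV. complex_of_real (\<xi> $ k) *
          cnj (perp_grad (\<lambda>x. gamma_dom D x (w $ k)) (w $ j)))"

definition fat_diagonal :: "(complex ^ 3) set" where
  "fat_diagonal = {w. \<exists>j k. j \<noteq> k \<and> w $ j = w $ k}"

definition vortex_solution ::
    "complex set \<Rightarrow> real ^ 3 \<Rightarrow> real \<Rightarrow> (real \<Rightarrow> complex ^ 3) \<Rightarrow> bool" where
  "vortex_solution D \<xi> T z \<longleftrightarrow>
     z C1_differentiable_on {0<..<T} \<and>
     (\<forall>t\<in>{0<..<T}. z t \<in> {w. \<forall>j. w $ j \<in> D} - fat_diagonal) \<and>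
     (\<forall>t\<in>{0<..<T}. \<forall>j.
        ((\<lambda>s. cnj (z s $ j)) has_vector_derivative vortex_rhs D \<xi> (z t) j) (at t))"

end

theory Submission
  imports Defs "HOL-Complex_Analysis.Complex_Analysis"
begin

text \<open>
  A Riemann map \<open>f\<close> of \<open>D\<close> onto the disc gives \<open>\<gamma>\<close> explicitly: \<open>-2\<pi> \<gamma>(x, y)\<close> is the real part of a
  holomorphic logarithm of \<open>(f x - f y) / ((x - y) (1 - cnj (f y) f x))\<close>, whose boundary values follow from
  \<open>|f| \<rightarrow> 1\<close> and which is unique by the maximum principle. Hence the image part of the vector field is
  Lipschitz near \<open>(z\<^sub>0, z\<^sub>0, z\<^sub>0)\<close>, by the maximum modulus principle on a circle around \<open>z\<^sub>0\<close>.

  For intensities proportional to \<open>-1, 2, 2\<close> the plane system has solutions expanding self-similarly out of a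
  point like \<open>sqrt t\<close>. In the rescaled rotating frame and the time \<open>s = sqrt t\<close> the self-similar triangle
  becomes an equilibrium, the image field becomes a perturbation of size \<open>s\<close>, and the linearisation
  has no eigenvalue of real part at least \<open>1\<close>. A contraction argument for functions of size \<open>s\<close> then produces a
  solution starting from the equilibrium at \<open>s = 0\<close>.
\<close>

section \<open>Harmonic functions and uniqueness for the Dirichlet problem\<close>

text \<open>The pairwise products of -1, 2, 2 add up to 0. The conserved logarithmic energy demands
  this of any self-similar expansion, and the conserved sum of \<xi>_j \<xi>_k |z_j - z_k|^2 must
  vanish too, which restricts the shape of the triangle. In the time s = sqrt t the velocity gains a
  factor 2 s while displacements carry a factor s, so a bounded image field stays bounded after
  rescaling and is one power of s weaker than the singular part s w' = A w. Multiplying by s^n and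
  integrating gives a contraction on functions of size s as soon as norm (A + n) < n + 1. The discs
  |\<lambda> + n| < n + 1 exhaust the half plane Re \<lambda> < 1, which is the origin of the bound
  1 on the real parts. Free modes s^\<lambda> with Re \<lambda> < 1 are larger than s near 0, so the
  neutral directions of rotation and energy do not disturb the fixed point. The obstacle is that a
  norm has to reflect the spectrum: 0 and -2 are double eigenvalues with Jordan blocks, hence the
  adapted coordinates.\<close>

lemma DERIV_line:
  fixes f :: "complex \<Rightarrow> real"
  assumes "f differentiable (at (x + of_real t * e))"
  shows "((\<lambda>t. f (x + of_real t * e)) has_real_derivative
           deriv (\<lambda>s. f (x + of_real t * e + of_real s * e)) 0) (at t)"
proof -
  let ?p = "x + of_real t * e"
  obtain f' where f': "(f has_derivative f') (at ?p)"
    using assms by (auto simp: differentiable_def)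
  have "((\<lambda>s. ?p + of_real s * e) has_derivative (\<lambda>s. of_real s * e)) (at 0)"
    by (auto intro!: derivative_eq_intros)
  then have "((\<lambda>s. f (?p + of_real s * e)) has_derivative (\<lambda>s. f' (of_real s * e))) (at 0)"
    by (rule has_derivative_compose) (use f' in simp)
  moreover have "f' (of_real s * e) = s * f' e" for s
    using linear_scale[OF has_derivative_linear[OF f'], of s e] by (simp add: scaleR_conv_of_real)
  ultimately have D: "((\<lambda>s. f (?p + of_real s * e)) has_real_derivative f' e) (at 0)"
    by (simp add: has_field_derivative_def mult.commute[of _ "f' e"] fun_eq_iff)
  \<comment> \<open>\<open>partial1\<close> and \<open>partial2\<close> differentiate at the
    parameter 0 only; the shift of the base point makes them derivatives along a whole line, as a
    second derivative test requires.\<close>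
  then have "((\<lambda>s. f (?p + of_real s * e)) has_real_derivative
      deriv (\<lambda>s. f (?p + of_real s * e)) 0) (at (t + - t))"
    by (simp add: DERIV_imp_deriv)
  then show ?thesis unfolding DERIV_shift by (simp add: algebra_simps)
qed

lemma partial1_DERIV:
  "f differentiable (at (x + of_real t)) \<Longrightarrow>
    ((\<lambda>t. f (x + of_real t)) has_real_derivative partial1 f (x + of_real t)) (at t)"
  using DERIV_line[of f x t 1] by (simp add: partial1_def)

lemma partial2_DERIV:
  "f differentiable (at (x + of_real t * \<i>)) \<Longrightarrow>
    ((\<lambda>t. f (x + of_real t * \<i>)) has_real_derivative partial2 f (x + of_real t * \<i>)) (at t)"
  using DERIV_line[of f x t \<i>] by (simp add: partial2_def)

text \<open>If \<open>d\<close> were positive, \<phi>' would be positive just to the right of its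
  zero at 0, and the mean value theorem would make \<phi> exceed its maximum there.\<close>

lemma local_max_second_deriv_nonpos:
  fixes \<phi> \<phi>' :: "real \<Rightarrow> real"
  assumes "r > 0" and D1: "\<And>t. \<bar>t\<bar> < r \<Longrightarrow> (\<phi> has_real_derivative \<phi>' t) (at t)"
    and D2: "(\<phi>' has_real_derivative d) (at 0)"
    and max: "\<And>t. \<bar>t\<bar> < r \<Longrightarrow> \<phi> t \<le> \<phi> 0"
  shows "d \<le> 0"
proof (rule ccontr)
  assume "\<not> d \<le> 0"
  have "\<phi>' 0 = 0"
    using D1[of 0] \<open>r > 0\<close> max by (intro DERIV_local_max[of \<phi> _ 0 r]) auto
  then obtain e where e: "e > 0" "\<And>h. 0 < h \<Longrightarrow> h < e \<Longrightarrow> \<phi>' h > 0"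
    using DERIV_pos_inc_right[OF D2] \<open>\<not> d \<le> 0\<close> by auto
  define s where "s = min e r / 2"
  have s: "0 < s" "s < e" "s < r" using e \<open>r > 0\<close> by (auto simp: s_def)
  obtain z where z: "0 < z" "z < s" "\<phi> s - \<phi> 0 = (s - 0) * \<phi>' z"
    using MVT2[of 0 s \<phi> \<phi>'] D1 s by auto
  have "\<phi>' z > 0" using z s e by auto
  then have "\<phi> s > \<phi> 0" using z s by (metis diff_gt_0_iff_gt diff_zero mult_pos_pos)
  then show False using max[of s] s by auto
qed

text \<open>The term \<epsilon> |y|^2 has Laplacian 4 \<epsilon>, so the perturbed difference has
  positive Laplacian and no interior maximum, where both pure second derivatives would be at most
  0.\<close>

lemma harmonic_comparison:
  fixes h1 h2 :: "complex \<Rightarrow> real"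
  assumes D: "open D" "bounded D"
    and h1: "continuous_on (closure D) h1" "C_k_on 2 h1 D" "\<And>y. y \<in> D \<Longrightarrow> laplacian h1 y = 0"
    and h2: "continuous_on (closure D) h2" "C_k_on 2 h2 D" "\<And>y. y \<in> D \<Longrightarrow> laplacian h2 y = 0"
    and bd: "\<And>y. y \<in> frontier D \<Longrightarrow> h1 y = h2 y"
    and x: "x \<in> closure D"
  shows "h1 x \<le> h2 x"
proof (rule ccontr)
  assume "\<not> h1 x \<le> h2 x"
  obtain B where B: "B > 0" "\<And>y. y \<in> closure D \<Longrightarrow> norm y \<le> B"
    using bounded_closure[OF D(2)] bounded_pos by blast
  \<comment> \<open>With this size the quadratic term, which is all that is left of the perturbed
    difference on the boundary, stays below the value at \<open>x\<close>.\<close>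
  define \<epsilon> where "\<epsilon> = (h1 x - h2 x) / (2 * B\<^sup>2)"
  have \<epsilon>: "\<epsilon> > 0" using \<open>\<not> h1 x \<le> h2 x\<close> B by (simp add: \<epsilon>_def)
  define w where "w = (\<lambda>y. h1 y - h2 y + \<epsilon> * ((Re y)\<^sup>2 + (Im y)\<^sup>2))"
  have "continuous_on (closure D) w" unfolding w_def by (intro continuous_intros h1 h2)
  then obtain p where p: "p \<in> closure D" "\<And>y. y \<in> closure D \<Longrightarrow> w y \<le> w p"
    using continuous_attains_sup[of "closure D" w] D(2) x by (metis compact_closure empty_iff)
  have "p \<in> D"
  proof (rule ccontr)
    assume "p \<notin> D"
    then have "p \<in> frontier D" using p(1) D(1) by (simp add: frontier_def interior_open)
    then have "w p = \<epsilon> * (norm p)\<^sup>2" using bd by (simp add: w_def cmod_power2)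
    also have "\<dots> \<le> \<epsilon> * B\<^sup>2" using \<epsilon> B(2)[OF p(1)] by (intro mult_left_mono power_mono) auto
    also have "\<dots> = (h1 x - h2 x) / 2" using B by (simp add: \<epsilon>_def)
    also have "\<dots> < h1 x - h2 x" using \<open>\<not> h1 x \<le> h2 x\<close> by simp
    also have "\<dots> \<le> w x" using \<epsilon> by (simp add: w_def)
    finally show False using p(2)[OF x] by simp
  qed
  then obtain r where r: "r > 0" "ball p r \<subseteq> D" using D(1) open_contains_ball by blast
  have inD: "p + of_real t \<in> D" "p + of_real t * \<i> \<in> D" if "\<bar>t\<bar> < r" for t
    using r(2) that by (auto simp: dist_norm subset_iff norm_mult)
  have df: "h differentiable (at y)" "partial1 h differentiable (at y)" "partial2 h differentiable (at y)"
    if "C_k_on 2 h D" "y \<in> D" for h y using that by (simp_all add: numeral_2_eq_2)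
  have "partial1 (partial1 h1) p - partial1 (partial1 h2) p + 2 * \<epsilon> \<le> 0"
  proof (rule local_max_second_deriv_nonpos[OF r(1)])
    show "((\<lambda>t. w (p + of_real t)) has_real_derivative
        partial1 h1 (p + of_real t) - partial1 h2 (p + of_real t) + \<epsilon> * (2 * (Re p + t))) (at t)"
      if "\<bar>t\<bar> < r" for t
      unfolding w_def
      by (rule derivative_eq_intros partial1_DERIV df h1 h2 inD that refl | simp)+
    show "((\<lambda>t. partial1 h1 (p + of_real t) - partial1 h2 (p + of_real t) + \<epsilon> * (2 * (Re p + t)))
        has_real_derivative partial1 (partial1 h1) p - partial1 (partial1 h2) p + 2 * \<epsilon>) (at 0)"
      using partial1_DERIV[of "partial1 h1" p 0] partial1_DERIV[of "partial1 h2" p 0] df h1 h2 \<open>p \<in> D\<close>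
      by (auto intro!: derivative_eq_intros)
    show "w (p + of_real t) \<le> w (p + of_real 0)" if "\<bar>t\<bar> < r" for t
      using p(2) inD(1)[OF that] closure_subset by auto
  qed
  moreover have "partial2 (partial2 h1) p - partial2 (partial2 h2) p + 2 * \<epsilon> \<le> 0"
  proof (rule local_max_second_deriv_nonpos[OF r(1)])
    show "((\<lambda>t. w (p + of_real t * \<i>)) has_real_derivative
        partial2 h1 (p + of_real t * \<i>) - partial2 h2 (p + of_real t * \<i>) + \<epsilon> * (2 * (Im p + t))) (at t)"
      if "\<bar>t\<bar> < r" for t
      unfolding w_def
      by (rule derivative_eq_intros partial2_DERIV df h1 h2 inD that refl | simp)+
    show "((\<lambda>t. partial2 h1 (p + of_real t * \<i>) - partial2 h2 (p + of_real t * \<i>) + \<epsilon> * (2 * (Im p + t)))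
        has_real_derivative partial2 (partial2 h1) p - partial2 (partial2 h2) p + 2 * \<epsilon>) (at 0)"
      using partial2_DERIV[of "partial2 h1" p 0] partial2_DERIV[of "partial2 h2" p 0] df h1 h2 \<open>p \<in> D\<close>
      by (auto intro!: derivative_eq_intros)
    show "w (p + of_real t * \<i>) \<le> w (p + of_real 0 * \<i>)" if "\<bar>t\<bar> < r" for t
      using p(2) inD(2)[OF that] closure_subset by auto
  qed
  ultimately have "laplacian h1 p - laplacian h2 p + 4 * \<epsilon> \<le> 0"
    unfolding laplacian_def by linarith
  then show False using h1(3) h2(3) \<open>p \<in> D\<close> \<epsilon> by simp
qed

lemma solves_dirichlet_unique:
  assumes "open D" "bounded D" "solves_dirichlet D g h1" "solves_dirichlet D g h2" "x \<in> closure D"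
  shows "h1 x = h2 x"
proof (rule antisym)
  show "h1 x \<le> h2 x" by (rule harmonic_comparison[of D]) (use assms in \<open>auto simp: solves_dirichlet_def\<close>)
  show "h2 x \<le> h1 x" by (rule harmonic_comparison[of D]) (use assms in \<open>auto simp: solves_dirichlet_def\<close>)
qed

lemma gamma_dom_eq:
  assumes "open D" "bounded D" "solves_dirichlet D (\<lambda>w. - green_plane x w) h" "y \<in> closure D"
  shows "gamma_dom D x y = h y"
  unfolding gamma_dom_def
proof (rule the_equality)
  show "\<exists>h'. solves_dirichlet D (\<lambda>w. - green_plane x w) h' \<and> h y = h' y" using assms by blast
  fix v assume "\<exists>h'. solves_dirichlet D (\<lambda>w. - green_plane x w) h' \<and> v = h' y"
  then obtain h' where h': "solves_dirichlet D (\<lambda>w. - green_plane x w) h'" "v = h' y" by auto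
  show "v = h y" unfolding h'(2) by (rule solves_dirichlet_unique[OF assms(1,2) h'(1) assms(3,4)])
qed

section \<open>Real parts of holomorphic functions\<close>

lemma partial_cong:
  assumes "open U" "\<And>x. x \<in> U \<Longrightarrow> f x = g x" "x \<in> U"
  shows "partial1 f x = partial1 g x" "partial2 f x = partial2 g x"
proof -
  have ev: "\<forall>\<^sub>F t :: real in nhds 0. f (x + of_real t * e) = g (x + of_real t * e)" for e
  proof -
    have "((\<lambda>t :: real. x + of_real t * e) \<longlongrightarrow> x + of_real 0 * e) (nhds 0)"
      by (intro tendsto_intros filterlim_ident)
    then have "\<forall>\<^sub>F t :: real in nhds 0. x + of_real t * e \<in> U"
      using assms(1,3) by (auto dest: topological_tendstoD)
    then show ?thesis by eventually_elim (rule assms(2))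
  qed
  show "partial1 f x = partial1 g x" "partial2 f x = partial2 g x"
    unfolding partial1_def partial2_def using ev[of 1] ev[of \<i>]
    by (auto intro!: deriv_cong_ev)
qed

lemma C_k_on_cong:
  assumes "open U" "\<And>x. x \<in> U \<Longrightarrow> f x = g x"
  shows "C_k_on n f U \<longleftrightarrow> C_k_on n g U"
  using assms(2)
proof (induction n arbitrary: f g)
  case 0
  then show ?case by (auto intro: continuous_on_cong)
next
  case (Suc n)
  have "f differentiable (at x) \<longleftrightarrow> g differentiable (at x)" if "x \<in> U" for x
    using has_derivative_transform_within_open[OF _ assms(1) that, of f _ UNIV g]
      has_derivative_transform_within_open[OF _ assms(1) that, of g _ UNIV f] Suc.prems
    unfolding differentiable_def by fastforce
  then show ?case
    using Suc.IH[of "partial1 f" "partial1 g"] Suc.IH[of "partial2 f" "partial2 g"]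
      partial_cong[OF assms(1), of f g] Suc.prems by auto
qed

lemma partial_Re_holomorphic:
  assumes "open U" "F holomorphic_on U" "x \<in> U"
  shows "partial1 (\<lambda>z. Re (F z)) x = Re (deriv F x)"
    and "partial2 (\<lambda>z. Re (F z)) x = Re (\<i> * deriv F x)"
    and "(\<lambda>z. Re (F z)) differentiable (at x)"
proof -
  have F: "(F has_field_derivative deriv F x) (at x)"
    using assms holomorphic_derivI by blast
  have line: "((\<lambda>t. Re (F (x + of_real t * e))) has_real_derivative Re (deriv F x * e)) (at 0)" for e
  proof -
    have "((\<lambda>t. x + of_real t * e) has_vector_derivative e) (at 0)"
      by (auto intro!: derivative_eq_intros simp: has_vector_derivative_def scaleR_conv_of_real)
    from field_vector_diff_chain_at[OF this, of F "deriv F x"] F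
    have "((\<lambda>t. F (x + of_real t * e)) has_vector_derivative e * deriv F x) (at 0)"
      by (simp add: o_def)
    from bounded_linear.has_vector_derivative[OF bounded_linear_Re this]
    show ?thesis by (simp only: has_real_derivative_iff_has_vector_derivative mult.commute)
  qed
  show "partial1 (\<lambda>z. Re (F z)) x = Re (deriv F x)" "partial2 (\<lambda>z. Re (F z)) x = Re (\<i> * deriv F x)"
    using line[of 1] line[of \<i>] unfolding partial1_def partial2_def
    by (simp_all add: DERIV_imp_deriv mult.commute)
  show "(\<lambda>z. Re (F z)) differentiable (at x)"
    using F unfolding differentiable_def has_field_derivative_def
    by (blast intro: bounded_linear.has_derivative[OF bounded_linear_Re])
qed

text \<open>The partial derivatives of Re F are Re F' and Re (i F'), again real parts of holomorphic
  functions, so the induction runs over all holomorphic \<open>F\<close> at once.\<close>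

lemma C_k_on_Re_holomorphic:
  assumes "open U" "F holomorphic_on U"
  shows "C_k_on n (\<lambda>z. Re (F z)) U"
  using assms(2)
proof (induction n arbitrary: F)
  case 0
  then show ?case by (auto intro!: continuous_intros holomorphic_on_imp_continuous_on)
next
  case (Suc n)
  have "deriv F holomorphic_on U" using Suc.prems assms(1) by (rule holomorphic_deriv)
  moreover have "(\<lambda>z. \<i> * deriv F z) holomorphic_on U"
    using calculation by (rule holomorphic_on_mult[OF holomorphic_on_const])
  ultimately have "C_k_on n (\<lambda>z. Re (deriv F z)) U" "C_k_on n (\<lambda>z. Re (\<i> * deriv F z)) U"
    using Suc.IH by blast+
  then have "C_k_on n (partial1 (\<lambda>z. Re (F z))) U" "C_k_on n (partial2 (\<lambda>z. Re (F z))) U"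
    by (simp_all only: C_k_on_cong[OF assms(1) partial_Re_holomorphic(1)[OF assms(1) Suc.prems]]
        C_k_on_cong[OF assms(1) partial_Re_holomorphic(2)[OF assms(1) Suc.prems]])
  then show ?case using partial_Re_holomorphic(3)[OF assms(1) Suc.prems] by simp
qed

lemma laplacian_Re_holomorphic:
  assumes "open U" "F holomorphic_on U" "x \<in> U"
  shows "laplacian (\<lambda>z. Re (F z)) x = 0"
proof -
  have d: "deriv F holomorphic_on U" using assms by (intro holomorphic_deriv)
  have d': "(\<lambda>z. \<i> * deriv F z) holomorphic_on U" 
    using d by (rule holomorphic_on_mult[OF holomorphic_on_const])
  have "partial1 (partial1 (\<lambda>z. Re (F z))) x = partial1 (\<lambda>z. Re (deriv F z)) x"
    "partial2 (partial2 (\<lambda>z. Re (F z))) x = partial2 (\<lambda>z. Re (\<i> * deriv F z)) x"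
    by (rule partial_cong[OF assms(1) _ assms(3)], rule partial_Re_holomorphic[OF assms(1,2)], assumption)+
  moreover have "deriv (\<lambda>z. \<i> * deriv F z) x = \<i> * deriv (deriv F) x"
    using d assms by (intro deriv_cmult) (auto simp: holomorphic_on_imp_differentiable_at)
  ultimately show ?thesis
    using partial_Re_holomorphic[OF assms(1) d assms(3)] partial_Re_holomorphic[OF assms(1) d' assms(3)]
    by (simp add: laplacian_def)
qed

lemma laplacian_cong:
  assumes "open U" "\<And>x. x \<in> U \<Longrightarrow> f x = g x" "x \<in> U"
  shows "laplacian f x = laplacian g x"
proof -
  have "partial1 (partial1 f) x = partial1 (partial1 g) x" "partial2 (partial2 f) x = partial2 (partial2 g) x"
    by (rule partial_cong[OF assms(1) _ assms(3)], rule partial_cong[OF assms(1,2)], assumption+)+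
  then show ?thesis by (simp add: laplacian_def)
qed

section \<open>The regular part of the Green function\<close>

text \<open>Divided by the first square, this expresses 1 minus the squared pseudohyperbolic
  distance of \<open>a\<close> and \<open>b\<close>; it tends to 0 as |a| tends to 1, uniformly in
  \<open>b\<close> on smaller discs.\<close>

lemma disc_pseudo_distance:
  "(norm (1 - cnj b * a))\<^sup>2 - (norm (a - b))\<^sup>2 = (1 - (norm a)\<^sup>2) * (1 - (norm b)\<^sup>2)"
  unfolding cmod_power2 by (simp add: power2_eq_square algebra_simps)

locale disc_map =
  fixes D :: "complex set" and f g :: "complex \<Rightarrow> complex"
  assumes D: "open D" "bounded D" "simply_connected D"
    and f: "f holomorphic_on D" and g: "g holomorphic_on ball 0 1"
    and gf: "\<And>z. z \<in> D \<Longrightarrow> norm (f z) < 1 \<and> g (f z) = z"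
    and fg: "\<And>z. z \<in> ball 0 1 \<Longrightarrow> g z \<in> D \<and> f (g z) = z"
begin

lemma inj: "inj_on f D"
  by (rule inj_on_inverseI[of _ g]) (use gf in blast)

lemma norm_f_boundary:
  assumes p: "p \<in> frontier D"
  shows "((\<lambda>z. norm (f z)) \<longlongrightarrow> 1) (at p within D)"
proof (rule order_tendstoI)
  fix a :: real assume "a < 1"
  have "continuous_on (cball 0 a) g"
    using \<open>a < 1\<close> by (intro continuous_on_subset[OF holomorphic_on_imp_continuous_on[OF g]]) auto
  then have "compact (g ` cball 0 a)" by (intro compact_continuous_image compact_cball)
  then have "open (- (g ` cball 0 a))" by (simp add: compact_imp_closed open_Compl)
  moreover have "p \<notin> g ` cball 0 a"
  proof
    assume "p \<in> g ` cball 0 a"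
    then have "p \<in> D" using fg \<open>a < 1\<close> by auto
    then show False using p D(1) by (simp add: frontier_def interior_open)
  qed
  ultimately have "\<forall>\<^sub>F z in at p within D. z \<in> - (g ` cball 0 a)"
    by (intro topological_tendstoD[OF tendsto_ident_at]) auto
  moreover have "\<forall>\<^sub>F z in at p within D. z \<in> D" by (simp add: eventually_at_filter)
  ultimately show "\<forall>\<^sub>F z in at p within D. a < norm (f z)"
  proof eventually_elim
    case (elim z)
    then have "f z \<notin> cball 0 a" using gf[of z] by (metis ComplD imageI)
    then show ?case by simp
  qed
next
  fix a :: real assume "1 < a"
  have "\<forall>\<^sub>F z in at p within D. z \<in> D" by (simp add: eventually_at_filter)
  then show "\<forall>\<^sub>F z in at p within D. norm (f z) < a"
    by eventually_elim (use gf \<open>1 < a\<close> in force)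
qed

lemma one_minus_nonzero: "x \<in> D \<Longrightarrow> y \<in> D \<Longrightarrow> 1 - cnj (f y) * f x \<noteq> 0"
proof
  assume xy: "x \<in> D" "y \<in> D" and "1 - cnj (f y) * f x = 0"
  then have "norm (f y) * norm (f x) = 1" by (metis complex_mod_cnj eq_iff_diff_eq_0 norm_mult norm_one)
  moreover have "norm (f y) * norm (f x) < 1 * 1"
    using gf xy by (intro mult_strict_mono') auto
  ultimately show False by simp
qed

text \<open>The removable singularity at x = y is filled by the derivative. As |f x| tends to 1,
  numerator and denominator |f x - f y| and |1 - cnj (f y) f x| become equal, so the modulus
  approaches 1 / |x - y|, the required boundary behaviour.\<close>

definition quot :: "complex \<Rightarrow> complex \<Rightarrow> complex" where
  "quot y x = (if x = y then deriv f y else (f x - f y) / (x - y)) / (1 - cnj (f y) * f x)"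

lemma quot_holomorphic: "y \<in> D \<Longrightarrow> quot y holomorphic_on D"
  unfolding quot_def
  by (intro holomorphic_on_divide pole_lemma_open D f holomorphic_intros) (use one_minus_nonzero in auto)

lemma quot_nonzero: "y \<in> D \<Longrightarrow> x \<in> D \<Longrightarrow> quot y x \<noteq> 0"
  using one_minus_nonzero[of x y] holomorphic_injective_imp_regular[OF f D(1) inj, of y] inj
  by (auto simp: quot_def inj_on_def)

text \<open>This is the symmetry of \<gamma>. The Dirichlet problem is solved in the second variable
  while the vector field differentiates in the first; symmetry makes \<gamma> the real part of a
  holomorphic function of the first one.\<close>

lemma norm_quot_commute: "norm (quot y x) = norm (quot x y)"
proof (cases "x = y")
  case False
  have "norm (1 - cnj (f y) * f x) = norm (1 - cnj (f x) * f y)"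
  proof -
    have "1 - cnj (f y) * f x = cnj (1 - cnj (f x) * f y)" by (simp add: mult.commute)
    then show ?thesis by (metis complex_mod_cnj)
  qed
  then show ?thesis using False by (simp add: quot_def norm_divide norm_mult norm_minus_commute)
qed simp

text \<open>Branches of the logarithm differ by constants in 2 pi i Z, which neither the real part
  in \<gamma> nor the derivative in the force can see, so an arbitrary choice is harmless.\<close>

definition log_quot :: "complex \<Rightarrow> complex \<Rightarrow> complex" where
  "log_quot y = (SOME G. G holomorphic_on D \<and> (\<forall>x\<in>D. quot y x = exp (G x)))"

lemma log_quot: assumes "y \<in> D" shows "log_quot y holomorphic_on D" "\<And>x. x \<in> D \<Longrightarrow> quot y x = exp (log_quot y x)"
proof -
  have "\<exists>G. G holomorphic_on D \<and> (\<forall>x\<in>D. quot y x = exp (G x))"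
    using simply_connected_eq_holomorphic_log[OF D(1)] D(3) quot_holomorphic[OF assms]
      quot_nonzero[OF assms] by blast
  from someI_ex[OF this] show "log_quot y holomorphic_on D" "\<And>x. x \<in> D \<Longrightarrow> quot y x = exp (log_quot y x)"
    unfolding log_quot_def by blast+
qed

lemma Re_log_quot: "y \<in> D \<Longrightarrow> x \<in> D \<Longrightarrow> Re (log_quot y x) = ln (norm (quot y x))"
  using log_quot(2)[of y x] by (simp add: norm_exp_eq_Re)

text \<open>
  In the disc the Green function is \<open>- (1 / (2 * pi))\<close> times the logarithm of the pseudohyperbolic
  distance; \<open>green_disc\<close> is that logarithm pulled back by \<open>f\<close> and extended by \<open>0\<close>. Off the
  diagonal it is the harmonic correction plus the logarithmic pole, which yields the boundary values.
\<close>

definition green_disc :: "complex \<Rightarrow> complex \<Rightarrow> real" where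
  "green_disc y x = (if x \<in> D then ln (norm ((f x - f y) / (1 - cnj (f y) * f x))) else 0)"

lemma Re_log_quot_green_disc:
  assumes "y \<in> D" "x \<in> D" "x \<noteq> y"
  shows "- (1 / (2 * pi)) * Re (log_quot y x) = - green_plane y x - 1 / (2 * pi) * green_disc y x"
proof -
  have nz: "norm (f x - f y) > 0" "norm (x - y) > 0" "norm (1 - cnj (f y) * f x) > 0"
    using assms one_minus_nonzero[of x y] inj by (auto simp: inj_on_def)
  then have *: "Re (log_quot y x) = green_disc y x - ln (norm (y - x))"
    using assms by (simp add: Re_log_quot quot_def green_disc_def norm_divide norm_mult ln_div ln_mult norm_minus_commute)
  show ?thesis unfolding * by (simp add: green_plane_def field_simps)
qed

text \<open>By \<open>disc_pseudo_distance\<close>, 1 minus the squared distance is at most (1 - |f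
  x|^2) / (1 - |f y|)^2, which tends to 0 at the boundary.\<close>

lemma green_disc_boundary:
  assumes "y \<in> D" "p \<in> frontier D"
  shows "(green_disc y \<longlongrightarrow> 0) (at p within closure D)"
proof -
  define m where "m = (\<lambda>x. norm ((f x - f y) / (1 - cnj (f y) * f x)))"
  have fy: "norm (f y) < 1" using gf assms by blast
  have "((\<lambda>x. (1 - (norm (f x))\<^sup>2) / (1 - norm (f y))\<^sup>2) \<longlongrightarrow> (1 - 1\<^sup>2) / (1 - norm (f y))\<^sup>2) (at p within D)"
    using fy by (intro tendsto_intros norm_f_boundary assms) auto
  then have lim: "((\<lambda>x. (1 - (norm (f x))\<^sup>2) / (1 - norm (f y))\<^sup>2) \<longlongrightarrow> 0) (at p within D)" by simp
  have "\<forall>\<^sub>F x in at p within D. norm (1 - (m x)\<^sup>2) \<le> (1 - (norm (f x))\<^sup>2) / (1 - norm (f y))\<^sup>2"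
  proof -
    have "\<forall>\<^sub>F x in at p within D. x \<in> D" by (simp add: eventually_at_filter)
    then show ?thesis
    proof eventually_elim
      case (elim x)
      define d where "d = norm (1 - cnj (f y) * f x)"
      have fx: "norm (f x) < 1" using gf elim by blast
      have "norm (cnj (f y) * f x) \<le> norm (f y) * 1"
        using fx by (simp add: norm_mult mult_left_le)
      then have d: "1 - norm (f y) \<le> d"
        using norm_triangle_ineq2[of 1 "cnj (f y) * f x"] by (simp add: d_def)
      then have d0: "d > 0" using fy by linarith
      have "1 - (m x)\<^sup>2 = (d\<^sup>2 - (norm (f x - f y))\<^sup>2) / d\<^sup>2"
      proof -
        have "m x = norm (f x - f y) / d" by (simp add: m_def d_def norm_divide)
        then show ?thesis using d0 by (simp add: power_divide diff_divide_distrib)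
      qed
      also have "\<dots> = (1 - (norm (f x))\<^sup>2) * (1 - (norm (f y))\<^sup>2) / d\<^sup>2"
        by (simp only: d_def disc_pseudo_distance)
      finally have e: "1 - (m x)\<^sup>2 = (1 - (norm (f x))\<^sup>2) * (1 - (norm (f y))\<^sup>2) / d\<^sup>2" .
      have q: "0 \<le> 1 - (norm (f x))\<^sup>2" "0 \<le> 1 - (norm (f y))\<^sup>2" "1 - (norm (f y))\<^sup>2 \<le> 1"
        using fx fy by (auto simp: power_le_one)
      have "(1 - (norm (f x))\<^sup>2) * (1 - (norm (f y))\<^sup>2) / d\<^sup>2 \<le> (1 - (norm (f x))\<^sup>2) * 1 / (1 - norm (f y))\<^sup>2"
        using q d fy by (intro frac_le mult_left_mono power_mono mult_nonneg_nonneg) auto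
      moreover have "0 \<le> (1 - (norm (f x))\<^sup>2) * (1 - (norm (f y))\<^sup>2) / d\<^sup>2"
        using q by simp
      ultimately show ?case unfolding e by simp
    qed
  qed
  from Lim_null_comparison[OF this lim] have "((\<lambda>x. 1 - (m x)\<^sup>2) \<longlongrightarrow> 0) (at p within D)" .
  from tendsto_diff[OF tendsto_const[of 1] this] have "((\<lambda>x. (m x)\<^sup>2) \<longlongrightarrow> 1) (at p within D)" by simp
  from tendsto_real_sqrt[OF this] have "(m \<longlongrightarrow> 1) (at p within D)" by (simp add: m_def)
  from tendsto_ln[OF this] have "((\<lambda>x. ln (m x)) \<longlongrightarrow> 0) (at p within D)" by simp
  then have 1: "(green_disc y \<longlongrightarrow> 0) (at p within D)"
    by (rule Lim_transform_eventually) (auto simp: eventually_at_filter green_disc_def m_def)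
  \<comment> \<open>Continuity on the closure also concerns approach along the boundary itself,
    where \<open>green_disc\<close> is 0 by convention.\<close>
  have 2: "(green_disc y \<longlongrightarrow> 0) (at p within (closure D - D))"
    by (rule Lim_transform_eventually[OF tendsto_const]) (auto simp: eventually_at_filter green_disc_def)
  have "closure D = D \<union> (closure D - D)" using closure_subset by auto
  then show ?thesis using 1 2 by (metis Lim_Un)
qed

definition dirichlet_solution :: "complex \<Rightarrow> complex \<Rightarrow> real" where
  "dirichlet_solution y x = (if x \<in> D then Re (- (1 / (2 * pi)) * log_quot y x) else - green_plane y x)"

lemma dirichlet_solution_solves:
  assumes y: "y \<in> D"
  shows "solves_dirichlet D (\<lambda>w. - green_plane y w) (dirichlet_solution y)"
  unfolding solves_dirichlet_def
proof (intro conjI ballI)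
  have hol: "(\<lambda>x. - (1 / (2 * pi)) * log_quot y x) holomorphic_on D"
    by (intro holomorphic_intros log_quot y)
  have eq: "\<And>x. x \<in> D \<Longrightarrow> dirichlet_solution y x = Re (- (1 / (2 * pi)) * log_quot y x)" by (simp add: dirichlet_solution_def)
  show "C_k_on 2 (dirichlet_solution y) D"
    using C_k_on_cong[OF D(1), of "dirichlet_solution y" "\<lambda>x. Re (- (1 / (2 * pi)) * log_quot y x)" 2, OF eq]
      C_k_on_Re_holomorphic[OF D(1) hol, of 2] by simp
  show "laplacian (dirichlet_solution y) x = 0" if "x \<in> D" for x
    using laplacian_cong[OF D(1), of "dirichlet_solution y" "\<lambda>x. Re (- (1 / (2 * pi)) * log_quot y x)" x, OF eq that]
      laplacian_Re_holomorphic[OF D(1) hol that] by simp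
  show "dirichlet_solution y x = - green_plane y x" if "x \<in> frontier D" for x
    using that D(1) by (simp add: dirichlet_solution_def frontier_def interior_open)
  show "continuous_on (closure D) (dirichlet_solution y)"
    unfolding continuous_on_eq_continuous_within
  proof
    fix p assume p: "p \<in> closure D"
    show "continuous (at p within closure D) (dirichlet_solution y)"
    proof (cases "p \<in> D")
      case True
      have "continuous_on D (dirichlet_solution y)"
        by (rule continuous_on_eq[of _ "\<lambda>x. Re (- (1 / (2 * pi)) * log_quot y x)"])
           (use continuous_on_Re[OF holomorphic_on_imp_continuous_on[OF hol]] eq in simp_all)
      then show ?thesis
        using True D(1) by (simp add: continuous_on_eq_continuous_at continuous_at_imp_continuous_at_within)
    next
      case False
      then have pf: "p \<in> frontier D" and py: "p \<noteq> y" using p y D(1) by (auto simp: frontier_def interior_open)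
      \<comment> \<open>This single formula describes the solution on both sides near
        \<open>p\<close>: in \<open>D\<close> it is the real part of the logarithm, on the boundary
        the second term drops out.\<close>
      have "((\<lambda>x. - green_plane y x - 1 / (2 * pi) * green_disc y x) \<longlongrightarrow>
           - green_plane y p - 1 / (2 * pi) * 0) (at p within closure D)"
        unfolding green_plane_def using py by (intro tendsto_intros green_disc_boundary y pf) auto
      moreover have "\<forall>\<^sub>F x in at p within closure D. - green_plane y x - 1 / (2 * pi) * green_disc y x = dirichlet_solution y x"
      proof -
        have "\<forall>\<^sub>F x in at p within closure D. x \<noteq> y"
          using py by (intro tendsto_imp_eventually_ne[OF tendsto_ident_at])
        then show ?thesis
        proof eventually_elim
          case (elim x)
          show ?case
          proof (cases "x \<in> D")
            case True
            then show ?thesis using Re_log_quot_green_disc[OF y True elim] eq[OF True] by simp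
          next
            case False
            then show ?thesis by (simp add: dirichlet_solution_def green_disc_def)
          qed
        qed
      qed
      ultimately have "(dirichlet_solution y \<longlongrightarrow> - green_plane y p) (at p within closure D)"
        by (auto intro: Lim_transform_eventually)
      then show ?thesis using False by (simp add: continuous_within dirichlet_solution_def)
    qed
  qed
qed

lemma gamma_dom_Re_log_quot:
  assumes "x \<in> D" "y \<in> D"
  shows "gamma_dom D x y = Re (- (1 / (2 * pi)) * log_quot y x)"
proof -
  have "gamma_dom D x y = dirichlet_solution x y"
    using assms closure_subset by (intro gamma_dom_eq D dirichlet_solution_solves) auto
  also have "\<dots> = - (1 / (2 * pi)) * ln (norm (quot x y))"
    using assms by (simp add: dirichlet_solution_def Re_log_quot)
  also have "\<dots> = Re (- (1 / (2 * pi)) * log_quot y x)"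
    using assms by (simp add: Re_log_quot norm_quot_commute[of x])
  finally show ?thesis .
qed

section \<open>The velocity induced by the boundary\<close>

definition image_kernel :: "complex \<Rightarrow> complex \<Rightarrow> complex" where
  "image_kernel x y = deriv (log_quot y) x"

text \<open>For a real part Re F the gradient is cnj F', its rotation i cnj F', and the conjugate of
  that is - i F'. Here F is - 1 / (2 pi) times \<open>log_quot y\<close>.\<close>

lemma cnj_perp_grad_gamma:
  assumes "x \<in> D" "y \<in> D"
  shows "cnj (perp_grad (\<lambda>x. gamma_dom D x y) x) = \<i> / (2 * pi) * image_kernel x y"
proof -
  have hol: "(\<lambda>x. - (1 / (2 * pi)) * log_quot y x) holomorphic_on D"
    by (intro holomorphic_intros log_quot assms)
  have d: "deriv (\<lambda>x. - (1 / (2 * pi)) * log_quot y x) x = - (1 / (2 * pi)) * image_kernel x y"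
    unfolding image_kernel_def using log_quot(1)[OF assms(2)] assms D(1)
    by (intro deriv_cmult) (auto simp: holomorphic_on_imp_differentiable_at)
  have "partial1 (\<lambda>x. gamma_dom D x y) x = partial1 (\<lambda>x. Re (- (1 / (2 * pi)) * log_quot y x)) x"
    "partial2 (\<lambda>x. gamma_dom D x y) x = partial2 (\<lambda>x. Re (- (1 / (2 * pi)) * log_quot y x)) x"
    by (rule partial_cong[OF D(1) _ assms(1)], rule gamma_dom_Re_log_quot[OF _ assms(2)], assumption)+
  then have "partial1 (\<lambda>x. gamma_dom D x y) x = Re (- (1 / (2 * pi)) * image_kernel x y)"
    "partial2 (\<lambda>x. gamma_dom D x y) x = Re (\<i> * (- (1 / (2 * pi)) * image_kernel x y))"
    using partial_Re_holomorphic[OF D(1) hol assms(1)] by (simp_all only: d)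
  then show ?thesis by (simp add: perp_grad_def complex_eq_iff)
qed

lemma image_kernel_holomorphic: "y \<in> D \<Longrightarrow> (\<lambda>x. image_kernel x y) holomorphic_on D"
  unfolding image_kernel_def by (intro holomorphic_deriv log_quot D)

text \<open>The kernel is the logarithmic derivative of \<open>quot\<close>, one term for each
  factor. The first two terms have poles at x = y that cancel only in their sum.\<close>

lemma image_kernel_off_diagonal:
  assumes "x \<in> D" "y \<in> D" "x \<noteq> y"
  shows "image_kernel x y = deriv f x / (f x - f y) - 1 / (x - y) + cnj (f y) * deriv f x / (1 - cnj (f y) * f x)"
proof -
  have nz: "f x - f y \<noteq> 0" "x - y \<noteq> 0" "1 - cnj (f y) * f x \<noteq> 0"
    using assms one_minus_nonzero[of x y] inj by (auto simp: inj_on_def)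
  have fd: "(f has_field_derivative deriv f x) (at x)"
    using holomorphic_derivI[OF f D(1) assms(1)] .
  have "((\<lambda>x. (f x - f y) / ((x - y) * (1 - cnj (f y) * f x))) has_field_derivative
     (deriv f x * ((x - y) * (1 - cnj (f y) * f x))
        - (f x - f y) * (1 - cnj (f y) * f x - deriv f x * cnj (f y) * (x - y)))
       / ((x - y) * (1 - cnj (f y) * f x) * ((x - y) * (1 - cnj (f y) * f x)))) (at x)"
    (is "(_ has_field_derivative ?d) _")
    using nz by (auto intro!: derivative_eq_intros fd)
  then have q: "(quot y has_field_derivative ?d) (at x)"
  proof (rule has_field_derivative_transform_within_open)
    show "open (- {y})" by (intro open_Compl closed_singleton)
    show "x \<in> - {y}" using assms by simp
    show "(f z - f y) / ((z - y) * (1 - cnj (f y) * f z)) = quot y z" if "z \<in> - {y}" for z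
      using that by (simp add: quot_def)
  qed
  have "(log_quot y has_field_derivative image_kernel x y) (at x)"
    unfolding image_kernel_def using holomorphic_derivI[OF log_quot(1)[OF assms(2)] D(1) assms(1)] .
  then have "((\<lambda>x. exp (log_quot y x)) has_field_derivative exp (log_quot y x) * image_kernel x y) (at x)"
    by (rule DERIV_chain2[OF DERIV_exp])
  then have "(quot y has_field_derivative exp (log_quot y x) * image_kernel x y) (at x)"
    by (rule has_field_derivative_transform_within_open[OF _ D(1) assms(1)]) (simp add: log_quot assms(2))
  then have "quot y x * image_kernel x y = ?d"
    using DERIV_unique[OF q] log_quot(2)[OF assms(2,1)] by simp
  then have "image_kernel x y = ?d / quot y x"
    using quot_nonzero[OF assms(2,1)] by (metis nonzero_mult_div_cancel_left)
  also have "\<dots> = deriv f x / (f x - f y) - 1 / (x - y) + cnj (f y) * deriv f x / (1 - cnj (f y) * f x)"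
  proof -
    define u where "u = f x - f y"
    define v where "v = x - y"
    define k where "k = 1 - cnj (f y) * f x"
    have "quot y x = u / v / k" using assms(3) by (simp add: quot_def u_def v_def k_def)
    then show ?thesis
      using nz unfolding u_def[symmetric] v_def[symmetric] k_def[symmetric]
      by (simp add: field_simps)
  qed
  finally show ?thesis .
qed

text \<open>Term by term the explicit formula blows up on the diagonal, so it is estimated only for
  \<open>x\<close> on a circle that stays away from \<open>y\<close>. Holomorphy in \<open>x\<close>
  carries the bounds to the inside, diagonal included.\<close>

lemma image_kernel_lipschitz:
  assumes "z\<^sub>0 \<in> D"
  obtains r M where "r > 0" "M \<ge> 0" "cball z\<^sub>0 r \<subseteq> D"
    "\<And>x y x' y'. x \<in> cball z\<^sub>0 r \<Longrightarrow> y \<in> cball z\<^sub>0 r \<Longrightarrow> x' \<in> cball z\<^sub>0 r \<Longrightarrow> y' \<in> cball z\<^sub>0 r \<Longrightarrow>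
       norm (image_kernel x y - image_kernel x' y') \<le> M * (norm (x - x') + norm (y - y'))"
proof -
  obtain R where R: "R > 0" "cball z\<^sub>0 R \<subseteq> D"
    using D(1) assms open_contains_cball by blast
  \<comment> \<open>Half the radius keeps the circle at distance \<open>r\<close> from every
    admissible \<open>y\<close>, and discs of radius \<open>r\<close> about points of the small disc
    inside the large one, as Cauchy's inequality below requires.\<close>
  define r where "r = R / 2"
  have r: "r > 0" "r < R" "cball z\<^sub>0 r \<subseteq> D" "cball z\<^sub>0 r \<subseteq> cball z\<^sub>0 R"
    using R by (auto simp: r_def)
  let ?K = "sphere z\<^sub>0 R \<times> cball z\<^sub>0 r"
  have KD: "x \<in> D" "y \<in> D" "x \<noteq> y" "norm (x - y) \<ge> r" if "x \<in> sphere z\<^sub>0 R" "y \<in> cball z\<^sub>0 r" for x y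
  proof -
    show "x \<in> D" "y \<in> D" using that R r by auto
    have "R \<le> norm (x - y) + r"
      using that dist_triangle[of z\<^sub>0 x y] by (auto simp: dist_norm norm_minus_commute)
    then show *: "norm (x - y) \<ge> r" by (simp add: r_def)
    show "x \<noteq> y" using * r by auto
  qed
  have fc: "continuous_on D f" using f by (rule holomorphic_on_imp_continuous_on)
  have f'c: "continuous_on D (deriv f)"
    using holomorphic_deriv[OF f D(1)] by (rule holomorphic_on_imp_continuous_on)
  have fcs: "continuous_on ?K (\<lambda>p. f (fst p))" "continuous_on ?K (\<lambda>p. f (snd p))"
    by (rule continuous_on_compose2[OF fc], (intro continuous_intros), use R(2) r(3) in force)+
  have ne: "?K \<noteq> {}"
  proof -
    have "(z\<^sub>0 + of_real R, z\<^sub>0) \<in> ?K" using R r by (simp add: dist_norm)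
    then show ?thesis by blast
  qed
  have cK: "compact ?K" by (intro compact_Times compact_sphere compact_cball)
  obtain m where m: "m > 0" "\<And>x y. x \<in> sphere z\<^sub>0 R \<Longrightarrow> y \<in> cball z\<^sub>0 r \<Longrightarrow> m \<le> norm (f x - f y)"
  proof -
    have "continuous_on ?K (\<lambda>p. norm (f (fst p) - f (snd p)))" by (intro continuous_intros fcs)
    from continuous_attains_inf[OF cK ne this]
    obtain a where a: "a \<in> ?K" "\<And>p. p \<in> ?K \<Longrightarrow> norm (f (fst a) - f (snd a)) \<le> norm (f (fst p) - f (snd p))"
      by blast
    have a': "fst a \<in> sphere z\<^sub>0 R" "snd a \<in> cball z\<^sub>0 r" using a(1) by auto
    have "f (fst a) \<noteq> f (snd a)" using inj KD(1-3)[OF a'] by (auto simp: inj_on_def)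
    then show ?thesis using a(2) by (intro that[of "norm (f (fst a) - f (snd a))"]) auto
  qed
  obtain k where k: "k > 0" "\<And>x y. x \<in> sphere z\<^sub>0 R \<Longrightarrow> y \<in> cball z\<^sub>0 r \<Longrightarrow> k \<le> norm (1 - cnj (f y) * f x)"
  proof -
    have "continuous_on ?K (\<lambda>p. norm (1 - cnj (f (snd p)) * f (fst p)))" by (intro continuous_intros fcs)
    from continuous_attains_inf[OF cK ne this]
    obtain a where a: "a \<in> ?K" "\<And>p. p \<in> ?K \<Longrightarrow>
        norm (1 - cnj (f (snd a)) * f (fst a)) \<le> norm (1 - cnj (f (snd p)) * f (fst p))" by blast
    have a': "fst a \<in> sphere z\<^sub>0 R" "snd a \<in> cball z\<^sub>0 r" using a(1) by auto
    have "1 - cnj (f (snd a)) * f (fst a) \<noteq> 0" by (rule one_minus_nonzero[OF KD(1,2)[OF a']])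
    then show ?thesis using a(2) by (intro that[of "norm (1 - cnj (f (snd a)) * f (fst a))"]) auto
  qed
  obtain B where B: "B > 0" "\<And>x. x \<in> cball z\<^sub>0 R \<Longrightarrow> norm (deriv f x) \<le> B"
  proof -
    have "bounded (deriv f ` cball z\<^sub>0 R)"
      by (intro compact_imp_bounded compact_continuous_image continuous_on_subset[OF f'c R(2)] compact_cball)
    then show ?thesis using that by (auto simp: bounded_pos)
  qed
  have Bs: "norm (deriv f x) \<le> B" if "x \<in> sphere z\<^sub>0 R" for x using B(2)[of x] that by simp
  have fl: "norm (f y - f y') \<le> B * norm (y - y')" if "y \<in> cball z\<^sub>0 r" "y' \<in> cball z\<^sub>0 r" for y y'
  proof (rule field_differentiable_bound[of "cball z\<^sub>0 r" f "deriv f"])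
    show "(f has_field_derivative deriv f z) (at z within cball z\<^sub>0 r)" if "z \<in> cball z\<^sub>0 r" for z
      using holomorphic_derivI[OF f D(1)] that r by (auto intro: has_field_derivative_at_within)
    show "norm (deriv f z) \<le> B" if "z \<in> cball z\<^sub>0 r" for z using B(2) that r by auto
  qed (use that in auto)
  have fn: "norm (f y) \<le> 1" if "y \<in> D" for y using gf[OF that] by simp
  define M0 where "M0 = B / m + 1 / r + B / k"
  have M0: "norm (image_kernel x y) \<le> M0" if "x \<in> sphere z\<^sub>0 R" "y \<in> cball z\<^sub>0 r" for x y
  proof -
    have "norm (deriv f x / (f x - f y)) \<le> B / m"
      unfolding norm_divide using m that Bs B(1) by (intro frac_le) auto
    moreover have "norm (1 / (x - y)) \<le> 1 / r"
      unfolding norm_divide using KD(4)[OF that] r by (intro frac_le) auto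
    moreover have "norm (cnj (f y) * deriv f x / (1 - cnj (f y) * f x)) \<le> B / k"
    proof -
      have "norm (cnj (f y)) * norm (deriv f x) \<le> 1 * B"
        using fn KD[OF that] Bs[OF that(1)] by (intro mult_mono) auto
      then show ?thesis unfolding norm_divide norm_mult using k that B(1) by (intro frac_le) auto
    qed
    ultimately have "norm (image_kernel x y) \<le> B / m + 1 / r + B / k"
      unfolding image_kernel_off_diagonal[OF KD(1-3)[OF that]]
      by (intro norm_triangle_le add_mono norm_triangle_le_diff) 
    then show ?thesis by (simp add: M0_def)
  qed
  define M1 where "M1 = B * B / (m * m) + 1 / (r * r) + B * B / (k * k)"
  have M1: "norm (image_kernel x y - image_kernel x y') \<le> M1 * norm (y - y')"
    if x: "x \<in> sphere z\<^sub>0 R" and y: "y \<in> cball z\<^sub>0 r" and y': "y' \<in> cball z\<^sub>0 r" for x y y'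
  proof -
    note a = KD[OF x y] KD[OF x y']
    have nz: "f x - f y \<noteq> 0" "f x - f y' \<noteq> 0" "x - y \<noteq> 0" "x - y' \<noteq> 0"
      "1 - cnj (f y) * f x \<noteq> 0" "1 - cnj (f y') * f x \<noteq> 0"
      using a m(2)[OF x y] m(2)[OF x y'] m(1) one_minus_nonzero by auto
    let ?a = "deriv f x * (f y - f y') / ((f x - f y) * (f x - f y'))"
    let ?b = "(y - y') / ((x - y) * (x - y'))"
    let ?c = "deriv f x * cnj (f y - f y') / ((1 - cnj (f y) * f x) * (1 - cnj (f y') * f x))"
    have e1: "deriv f x / (f x - f y) - deriv f x / (f x - f y') = ?a"
      using nz by (simp add: divide_simps) (simp add: algebra_simps)
    have e2: "1 / (x - y) - 1 / (x - y') = ?b"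
      using nz by (simp add: divide_simps)
    have e3: "cnj (f y) * deriv f x / (1 - cnj (f y) * f x) - cnj (f y') * deriv f x / (1 - cnj (f y') * f x) = ?c"
      using nz by (simp add: divide_simps) (simp add: algebra_simps)
    have "image_kernel x y - image_kernel x y' = ?a - ?b + ?c"
      unfolding image_kernel_off_diagonal[OF a(1-3)] image_kernel_off_diagonal[OF a(5-7)] e1[symmetric] e2[symmetric] e3[symmetric]
      by simp
    moreover have "norm ?a \<le> B * (B * norm (y - y')) / (m * m)"
      unfolding norm_divide norm_mult
      using Bs[OF x] fl[OF y y'] m(1) m(2)[OF x y] m(2)[OF x y'] B(1) by (intro frac_le mult_mono) auto
    moreover have "norm ?b \<le> norm (y - y') / (r * r)"
      unfolding norm_divide norm_mult
      using a r by (intro frac_le mult_mono) auto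
    moreover have "norm ?c \<le> B * (B * norm (y - y')) / (k * k)"
      unfolding norm_divide norm_mult complex_mod_cnj
      using Bs[OF x] fl[OF y y'] k(1) k(2)[OF x y] k(2)[OF x y'] B(1) by (intro frac_le mult_mono) auto
    ultimately have "norm (image_kernel x y - image_kernel x y') \<le>
        B * (B * norm (y - y')) / (m * m) + norm (y - y') / (r * r) + B * (B * norm (y - y')) / (k * k)"
      by (metis add_mono norm_triangle_le norm_triangle_le_diff)
    then show ?thesis by (simp add: M1_def algebra_simps)
  qed
  have M01: "M0 \<ge> 0" "M1 \<ge> 0" using B m k r by (auto simp: M0_def M1_def)
  have maxmod: "norm (F x) \<le> C"
    if "F holomorphic_on D" "\<And>z. z \<in> sphere z\<^sub>0 R \<Longrightarrow> norm (F z) \<le> C" "x \<in> cball z\<^sub>0 R" for F x C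
  proof (rule maximum_modulus_frontier[of F "cball z\<^sub>0 R"])
    show "F holomorphic_on interior (cball z\<^sub>0 R)"
      by (rule holomorphic_on_subset[OF that(1) order_trans[OF interior_subset R(2)]])
    show "continuous_on (closure (cball z\<^sub>0 R)) F"
      using holomorphic_on_imp_continuous_on[OF that(1)] R by (auto intro: continuous_on_subset)
  qed (use that in \<open>auto simp: frontier_cball\<close>)
  \<comment> \<open>The kernel is not holomorphic in \<open>y\<close>, but its difference for two
    fixed values of \<open>y\<close> is holomorphic in \<open>x\<close>, and this is what the
    maximum principle is applied to.\<close>
  have Ly: "norm (image_kernel x y - image_kernel x y') \<le> M1 * norm (y - y')"
    if "x \<in> cball z\<^sub>0 r" "y \<in> cball z\<^sub>0 r" "y' \<in> cball z\<^sub>0 r" for x y y'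
  proof (rule maxmod[where F = "\<lambda>x. image_kernel x y - image_kernel x y'"])
    show "(\<lambda>x. image_kernel x y - image_kernel x y') holomorphic_on D"
      using that r by (intro holomorphic_intros image_kernel_holomorphic) auto
  qed (use that M1 r in auto)
  have Lx: "norm (image_kernel x y - image_kernel x' y) \<le> M0 / r * norm (x - x')"
    if x: "x \<in> cball z\<^sub>0 r" "x' \<in> cball z\<^sub>0 r" and y: "y \<in> cball z\<^sub>0 r" for x x' y
  proof (rule field_differentiable_bound[of "cball z\<^sub>0 r" "\<lambda>x. image_kernel x y" "deriv (\<lambda>x. image_kernel x y)"])
    have hol: "(\<lambda>x. image_kernel x y) holomorphic_on D" using y r by (intro image_kernel_holomorphic) auto
    fix z assume z: "z \<in> cball z\<^sub>0 r"
    show "((\<lambda>x. image_kernel x y) has_field_derivative deriv (\<lambda>x. image_kernel x y) z) (at z within cball z\<^sub>0 r)"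
      using holomorphic_derivI[OF hol D(1)] z r by (auto intro: has_field_derivative_at_within)
    have sub: "cball z r \<subseteq> cball z\<^sub>0 R"
    proof
      fix u assume "u \<in> cball z r"
      then show "u \<in> cball z\<^sub>0 R"
        using z dist_triangle[of z\<^sub>0 u z] by (simp add: r_def)
    qed
    have "norm ((deriv ^^ 1) (\<lambda>x. image_kernel x y) z) \<le> fact 1 * M0 / r ^ 1"
    proof (rule Cauchy_inequality)
      show "(\<lambda>x. image_kernel x y) holomorphic_on ball z r"
        using hol sub R ball_subset_cball by (blast intro: holomorphic_on_subset)
      show "continuous_on (cball z r) (\<lambda>x. image_kernel x y)"
        using holomorphic_on_imp_continuous_on[OF hol] sub R by (blast intro: continuous_on_subset)
      show "norm (image_kernel u y) \<le> M0" if "norm (z - u) = r" for u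
      proof (rule maxmod[OF hol])
        show "u \<in> cball z\<^sub>0 R" using sub that by (auto simp: dist_norm)
      qed (use M0 y in auto)
    qed (use r in auto)
    then show "norm (deriv (\<lambda>x. image_kernel x y) z) \<le> M0 / r" by simp
  qed (use x in auto)
  show ?thesis
  proof (rule that[of r "M0 / r + M1"])
    fix x y x' y' assume *: "x \<in> cball z\<^sub>0 r" "y \<in> cball z\<^sub>0 r" "x' \<in> cball z\<^sub>0 r" "y' \<in> cball z\<^sub>0 r"
    have "norm (image_kernel x y - image_kernel x' y') \<le> norm (image_kernel x y - image_kernel x' y) + norm (image_kernel x' y - image_kernel x' y')"
      using norm_triangle_ineq[of "image_kernel x y - image_kernel x' y" "image_kernel x' y - image_kernel x' y'"] by simp
    also have "\<dots> \<le> M0 / r * norm (x - x') + M1 * norm (y - y')"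
      using * by (intro add_mono Lx Ly)
    also have "\<dots> \<le> (M0 / r + M1) * norm (x - x') + (M0 / r + M1) * norm (y - y')"
      using M01 r by (intro add_mono mult_right_mono) auto
    finally show "norm (image_kernel x y - image_kernel x' y') \<le> (M0 / r + M1) * (norm (x - x') + norm (y - y'))"
      by (simp add: algebra_simps)
  qed (use r M01 in auto)
qed

end

section \<open>An ordinary differential equation with a regular singular point\<close>

lemma norm_integral_power_le:
  fixes H :: "real \<Rightarrow> 'a::banach"
  assumes "0 \<le> s" and "continuous_on {0..s} H" and "\<And>x. x \<in> {0..s} \<Longrightarrow> norm (H x) \<le> k * x ^ n"
  shows "norm (integral {0..s} H) \<le> k * s ^ (n + 1) / real (n + 1)"
proof -
  have "((\<lambda>x. k * x ^ n) has_integral k * s ^ (n+1) / real (n+1) - k * 0 ^ (n+1) / real (n+1)) {0..s}"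
  proof (rule fundamental_theorem_of_calculus[OF \<open>0 \<le> s\<close>])
    fix x :: real assume "x \<in> {0..s}"
    have "((\<lambda>x. k * x ^ (n+1) / real (n+1)) has_real_derivative k * x ^ n) (at x within {0..s})"
      by (rule derivative_eq_intros refl | simp)+
    then show "((\<lambda>x. k * x ^ (n+1) / real (n+1)) has_vector_derivative k * x ^ n) (at x within {0..s})"
      by (simp add: has_real_derivative_iff_has_vector_derivative)
  qed
  then have I: "((\<lambda>x. k * x ^ n) has_integral k * s ^ (n+1) / real (n+1)) {0..s}" by simp
  have "norm (integral {0..s} H) \<le> integral {0..s} (\<lambda>x. k * x ^ n)"
    using assms I by (intro integral_norm_bound_integral) (auto simp: integrable_continuous_interval)
  also have "\<dots> = k * s ^ (n+1) / real (n+1)" using I by (rule integral_unique)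
  finally show ?thesis .
qed

text \<open>
  The equation is \<open>s w' = R w - n w + s P s w\<close>. Written as the fixed point problem that \<open>s ^ n w s\<close> is the
  integral over \<open>[0, s]\<close> of \<open>x ^ (n - 1) (R w + x P x w)\<close>, it is a contraction for the weight \<open>1 / s\<close> as
  soon as the Lipschitz constant of \<open>R\<close> is below \<open>n + 1\<close>. The Banach space is realised as bounded
  continuous functions of \<open>ln s\<close>, so that \<open>w s / s\<close> need not have a limit at \<open>0\<close>.
\<close>

theorem singular_ode_solution:
  fixes R :: "'a::banach \<Rightarrow> 'a" and P :: "real \<Rightarrow> 'a \<Rightarrow> 'a" and n :: nat
  assumes n: "n \<ge> 1" and r: "r > 0" and S0: "S0 > 0" and \<rho>: "0 \<le> \<rho>" "\<rho> < real n + 1"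
    and R0: "R 0 = 0"
    and RL: "\<And>u v. u \<in> cball 0 r \<Longrightarrow> v \<in> cball 0 r \<Longrightarrow> norm (R u - R v) \<le> \<rho> * norm (u - v)"
    and Pc: "continuous_on ({0<..S0} \<times> cball 0 r) (\<lambda>(s, u). P s u)"
    and PB: "\<And>s u. s \<in> {0<..S0} \<Longrightarrow> u \<in> cball 0 r \<Longrightarrow> norm (P s u) \<le> B"
    and PL: "\<And>s u v. s \<in> {0<..S0} \<Longrightarrow> u \<in> cball 0 r \<Longrightarrow> v \<in> cball 0 r \<Longrightarrow>
               norm (P s u - P s v) \<le> M * norm (u - v)"
  obtains S w where "0 < S" "S \<le> S0" "continuous_on {0..S} w" "w 0 = 0" "w ` {0..S} \<subseteq> cball 0 r"
    "\<And>s. s \<in> {0<..<S} \<Longrightarrow>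
       (w has_vector_derivative (1 / s) *\<^sub>R (R (w s) - real n *\<^sub>R w s) + P s (w s)) (at s)"
proof -
  have "0 \<le> B"
    using order_trans[OF norm_ge_zero PB[of S0 0]] S0 r by simp
  define g where "g = real n + 1 - \<rho>"
  have g: "g > 0" using \<rho> by (simp add: g_def)
  \<comment> \<open>The solution of (\<rho> b + B) / (n + 1) = b, so that the fixed point map
    preserves the ball of radius \<open>b\<close> exactly.\<close>
  define b where "b = B / g"
  have b: "b \<ge> 0" using \<open>0 \<le> B\<close> g by (simp add: b_def)
  \<comment> \<open>The second entry keeps functions bounded by \<open>s * b\<close> in the ball of
    radius \<open>r\<close>; the third lets the Lipschitz constant of the perturbation use up only
    half of the gap \<open>g\<close>.\<close>
  define S where "S = Min {S0, r / (b + 1), g / (2 * (\<bar>M\<bar> + 1))}"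
  have S: "0 < S" "S \<le> S0" "S \<le> r / (b + 1)" "S \<le> g / (2 * (\<bar>M\<bar> + 1))"
    using S0 r b g by (auto simp: S_def)
  have Sb: "S * b \<le> r"
  proof -
    have "S * (b + 1) \<le> r" using S(3) b by (simp add: field_simps)
    then show ?thesis using S(1) by (simp add: algebra_simps)
  qed
  have SM: "\<bar>M\<bar> * S \<le> g / 2"
  proof -
    have "S * (2 * (\<bar>M\<bar> + 1)) \<le> g" using S(4) by (simp add: pos_le_divide_eq)
    then show ?thesis using S(1) by (simp add: algebra_simps)
  qed
  \<comment> \<open>The factor \<open>s\<close> encodes the weight. It also gives
    \<open>W \<phi> 0 = 0\<close> whatever value \<open>ln 0\<close> has.\<close>
  define W where "W = (\<lambda>(\<phi> :: real \<Rightarrow>\<^sub>C 'a) s. s *\<^sub>R apply_bcontfun \<phi> (ln s))"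
  define H where "H = (\<lambda>\<phi> s. s ^ (n - 1) *\<^sub>R (R (W \<phi> s) + s *\<^sub>R P s (W \<phi> s)))"
  define X where "X = cball (0 :: real \<Rightarrow>\<^sub>C 'a) b"
  have Wn: "norm (W \<phi> s) \<le> s * b" if "\<phi> \<in> X" "s \<ge> 0" for \<phi> s
  proof -
    have "norm (apply_bcontfun \<phi> (ln s)) \<le> b"
      using that norm_bounded[of \<phi> "ln s"] by (auto simp: X_def)
    then show ?thesis using that by (simp add: W_def mult_left_mono)
  qed
  have Wr: "W \<phi> s \<in> cball 0 r" if "\<phi> \<in> X" "s \<in> {0..S}" for \<phi> s
  proof -
    have "norm (W \<phi> s) \<le> s * b" using that by (intro Wn) auto
    also have "\<dots> \<le> S * b" using that b by (intro mult_right_mono) auto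
    finally show ?thesis using Sb by simp
  qed
  have pw: "s ^ (n - 1) * s = s ^ n" for s :: real
    using n by (metis Suc_diff_1 power_Suc2 less_eq_Suc_le One_nat_def)
  have Rb: "norm (R u) \<le> \<rho> * norm u" if "u \<in> cball 0 r" for u
    using RL[of u 0] that r R0 by simp
  have Hb: "norm (H \<phi> s) \<le> (\<rho> * b + B) * s ^ n" if "\<phi> \<in> X" "s \<in> {0..S}" for \<phi> s
  proof (cases "s = 0")
    case True
    \<comment> \<open>Nothing is known about \<open>P\<close> at 0, but it is multiplied by 0 there.
      For n = 1 the power \<open>0 ^ (n - 1)\<close> is 1, and \<open>R 0 = 0\<close> makes the
      integrand vanish.\<close>
    then show ?thesis using R0 n by (simp add: H_def W_def power_0_left)
  next
    case False
    then have s: "s > 0" "s \<in> {0<..S0}" using that S by auto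
    have "norm (R (W \<phi> s) + s *\<^sub>R P s (W \<phi> s)) \<le> \<rho> * (s * b) + s * B"
    proof (rule norm_triangle_le, rule add_mono)
      show "norm (R (W \<phi> s)) \<le> \<rho> * (s * b)"
        using Rb[OF Wr[OF that]] Wn[OF that(1), of s] s \<rho>
        by (meson order_trans mult_left_mono less_imp_le)
      show "norm (s *\<^sub>R P s (W \<phi> s)) \<le> s * B"
        using PB[OF s(2) Wr[OF that]] s by (simp add: mult_left_mono)
    qed
    then have "norm (H \<phi> s) \<le> s ^ (n - 1) * (\<rho> * (s * b) + s * B)"
      using s by (simp add: H_def mult_left_mono)
    also have "\<dots> = (\<rho> * b + B) * (s ^ (n - 1) * s)" by (simp add: algebra_simps)
    finally show ?thesis by (simp only: pw)
  qed
  have Wc: "continuous_on {0<..S} (W \<phi>)" for \<phi>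
  proof -
    have "continuous_on {0<..S} (\<lambda>s. apply_bcontfun \<phi> (ln s))"
      by (rule continuous_on_compose2[of UNIV "apply_bcontfun \<phi>"]) (auto intro!: continuous_intros)
    then show ?thesis unfolding W_def by (intro continuous_intros)
  qed
  have Hc: "continuous_on {0..S} (H \<phi>)" if \<phi>: "\<phi> \<in> X" for \<phi>
  proof -
    have "continuous_on (cball 0 r) R"
      by (rule lipschitz_on_continuous_on[of \<rho>], rule lipschitz_onI)
         (use RL \<rho> in \<open>auto simp: dist_norm\<close>)
    then have "continuous_on {0<..S} (\<lambda>s. R (W \<phi> s))"
      by (rule continuous_on_compose2) (use Wr \<phi> in \<open>auto intro: Wc\<close>)
    moreover have "continuous_on {0<..S} (\<lambda>s. P s (W \<phi> s))"
    proof -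
      have "continuous_on {0<..S} (\<lambda>s. (s, W \<phi> s))"
        by (intro continuous_intros Wc)
      from continuous_on_compose2[OF Pc this] show ?thesis
        using S Wr[OF \<phi>] by force
    qed
    ultimately have c: "continuous_on {0<..S} (H \<phi>)"
      unfolding H_def by (intro continuous_intros)
    show ?thesis
      unfolding continuous_on_eq_continuous_within
    proof
      fix s assume s: "s \<in> {0..S}"
      show "continuous (at s within {0..S}) (H \<phi>)"
      proof (cases "s = 0")
        case True
        have "((\<lambda>s. (\<rho> * b + B) * s ^ n) \<longlongrightarrow> (\<rho> * b + B) * 0 ^ n) (at 0 within {0..S})"
          by (intro tendsto_intros)
        then have "((\<lambda>s. (\<rho> * b + B) * s ^ n) \<longlongrightarrow> 0) (at 0 within {0..S})"
          using n by (simp add: power_0_left)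
        then have "(H \<phi> \<longlongrightarrow> 0) (at 0 within {0..S})"
          by (rule Lim_null_comparison[rotated]) (use Hb[OF \<phi>] in \<open>auto simp: eventually_at_filter\<close>)
        moreover have "H \<phi> 0 = 0" using R0 by (simp add: H_def W_def)
        ultimately show ?thesis using True by (simp add: continuous_within)
      next
        case False
        then have "s \<in> {0<..S}" using s by auto
        then have "continuous (at s within {0<..S}) (H \<phi>)"
          using c by (simp add: continuous_on_eq_continuous_within)
        moreover have "at s within {0<..S} = at s within {0..S}"
          using False s by (intro at_within_nhd[of s "{0<..}"]) auto
        ultimately show ?thesis by (simp add: continuous_within)
      qed
    qed
  qed
  define I where "I = (\<lambda>\<phi> s. integral {0..s} (H \<phi>))"
  have Ic: "continuous_on {0..S} (I \<phi>)" if "\<phi> \<in> X" for \<phi>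
    unfolding I_def using Hc[OF that]
    by (intro indefinite_integral_continuous_1 integrable_continuous_interval)
  \<comment> \<open>Freezing the time at \<open>S\<close> extends the integral to all of the real
    line in the variable \<tau> = ln s, as a bounded continuous function on the whole type
    requires.\<close>
  define m where "m = (\<lambda>\<tau>. min S (exp \<tau>))"
  have m: "m \<tau> \<in> {0<..S}" "0 < m \<tau>" "m \<tau> \<le> S" for \<tau> using S by (auto simp: m_def)
  define F where "F = (\<lambda>\<phi> \<tau>. (1 / m \<tau> ^ (n + 1)) *\<^sub>R I \<phi> (m \<tau>))"
  have Fb: "norm (F \<phi> \<tau>) \<le> b" if \<phi>: "\<phi> \<in> X" for \<phi> \<tau>
  proof -
    have "norm (I \<phi> (m \<tau>)) \<le> (\<rho> * b + B) * m \<tau> ^ (n + 1) / real (n + 1)"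
      unfolding I_def
    proof (rule norm_integral_power_le)
      show "continuous_on {0..m \<tau>} (H \<phi>)"
        using Hc[OF \<phi>] by (rule continuous_on_subset) (use m[of \<tau>] in auto)
    qed (use m[of \<tau>] Hb[OF \<phi>] in auto)
    then have "norm (F \<phi> \<tau>) \<le> (\<rho> * b + B) / real (n + 1)"
      using m[of \<tau>] by (simp add: F_def field_simps)
    also have "\<dots> = b"
    proof -
      have "B = b * g" using g by (simp add: b_def)
      then have "\<rho> * b + B = b * (real n + 1)" by (simp add: g_def algebra_simps)
      then show ?thesis by (simp add: add.commute)
    qed
    finally show ?thesis .
  qed
  have Fc: "F \<phi> \<in> bcontfun" if \<phi>: "\<phi> \<in> X" for \<phi>
  proof (rule bcontfun_normI)
    have mc: "continuous_on UNIV m" unfolding m_def by (intro continuous_intros)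
    have "continuous_on UNIV (\<lambda>\<tau>. I \<phi> (m \<tau>))"
      by (rule continuous_on_compose2[OF Ic[OF \<phi>] mc]) (auto simp: m less_imp_le)
    then show "continuous_on UNIV (F \<phi>)"
      unfolding F_def using m(2) by (intro continuous_intros mc) (auto simp: less_imp_neq[symmetric])
  qed (rule Fb[OF \<phi>])
  define T where "T = (\<lambda>\<phi>. Bcontfun (F \<phi>))"
  have T: "apply_bcontfun (T \<phi>) = F \<phi>" if "\<phi> \<in> X" for \<phi>
    using Fc[OF that] by (simp add: T_def Bcontfun_inverse)
  \<comment> \<open>\<rho> comes from \<open>R\<close> and half of the gap from \<open>P\<close>;
    since \<rho> + g = n + 1, the quotient is below 1.\<close>
  define c where "c = (\<rho> + g / 2) / real (n + 1)"
  have c: "0 \<le> c" "c < 1" using \<rho> g by (auto simp: c_def g_def field_simps)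
  have TX: "T ` X \<subseteq> X"
  proof
    fix \<psi> assume "\<psi> \<in> T ` X"
    then obtain \<phi> where "\<phi> \<in> X" "\<psi> = T \<phi>" by auto
    then have "norm \<psi> \<le> b" using T Fb by (intro norm_bound) auto
    then show "\<psi> \<in> X" by (simp add: X_def)
  qed
  have contr: "dist (T \<phi>) (T \<psi>) \<le> c * dist \<phi> \<psi>" if \<phi>: "\<phi> \<in> X" and \<psi>: "\<psi> \<in> X" for \<phi> \<psi>
  proof (rule dist_bound)
    fix \<tau>
    define d where "d = dist \<phi> \<psi>"
    have Wd: "norm (W \<phi> s - W \<psi> s) \<le> s * d" if "s \<ge> 0" for s
    proof -
      have "norm (apply_bcontfun \<phi> (ln s) - apply_bcontfun \<psi> (ln s)) \<le> d"
        using dist_bounded[of \<phi> "ln s" \<psi>] by (simp add: d_def dist_norm)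
      then show ?thesis using that
        by (simp add: W_def mult_left_mono flip: scaleR_right_diff_distrib)
    qed
    have Hd: "norm (H \<phi> s - H \<psi> s) \<le> ((\<rho> + g / 2) * d) * s ^ n" if s: "s \<in> {0..S}" for s
    proof (cases "s = 0")
      case True
      then show ?thesis using n by (simp add: H_def W_def power_0_left)
    next
      case False
      then have s': "s > 0" "s \<in> {0<..S0}" using s S by auto
      have "norm ((R (W \<phi> s) - R (W \<psi> s)) + s *\<^sub>R (P s (W \<phi> s) - P s (W \<psi> s)))
            \<le> \<rho> * (s * d) + s * (g / 2 * d)"
      proof (rule norm_triangle_le, rule add_mono)
        show "norm (R (W \<phi> s) - R (W \<psi> s)) \<le> \<rho> * (s * d)"
          using RL[OF Wr[OF \<phi> s] Wr[OF \<psi> s]] Wd[of s] s' \<rho>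
          by (meson order_trans mult_left_mono less_imp_le)
        have "norm (P s (W \<phi> s) - P s (W \<psi> s)) \<le> M * norm (W \<phi> s - W \<psi> s)"
          by (rule PL[OF s'(2) Wr[OF \<phi> s] Wr[OF \<psi> s]])
        also have "\<dots> \<le> \<bar>M\<bar> * (s * d)"
          using Wd[of s] s' by (intro mult_mono) auto
        also have "\<dots> \<le> g / 2 * d"
        proof -
          have "\<bar>M\<bar> * s \<le> \<bar>M\<bar> * S" using s by (intro mult_left_mono) auto
          also note SM
          finally have "\<bar>M\<bar> * s * d \<le> g / 2 * d" by (intro mult_right_mono) (auto simp: d_def)
          then show ?thesis by (simp add: mult_ac)
        qed
        finally show "norm (s *\<^sub>R (P s (W \<phi> s) - P s (W \<psi> s))) \<le> s * (g / 2 * d)"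
          using s' by (simp add: mult_left_mono)
      qed
      then have "s ^ (n - 1) * norm ((R (W \<phi> s) - R (W \<psi> s)) + s *\<^sub>R (P s (W \<phi> s) - P s (W \<psi> s)))
          \<le> s ^ (n - 1) * (\<rho> * (s * d) + s * (g / 2 * d))"
        using s' by (intro mult_left_mono) auto
      also have "s ^ (n - 1) * norm ((R (W \<phi> s) - R (W \<psi> s)) + s *\<^sub>R (P s (W \<phi> s) - P s (W \<psi> s)))
          = norm (H \<phi> s - H \<psi> s)"
      proof -
        have "H \<phi> s - H \<psi> s =
          s ^ (n - 1) *\<^sub>R ((R (W \<phi> s) - R (W \<psi> s)) + s *\<^sub>R (P s (W \<phi> s) - P s (W \<psi> s)))"
          by (simp add: H_def algebra_simps)
        then show ?thesis using s' by simp
      qed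
      also have "s ^ (n - 1) * (\<rho> * (s * d) + s * (g / 2 * d)) = ((\<rho> + g / 2) * d) * (s ^ (n - 1) * s)"
        by (simp add: algebra_simps)
      finally show ?thesis by (simp only: pw)
    qed
    have c': "continuous_on {0..m \<tau>} (H \<phi>)" "continuous_on {0..m \<tau>} (H \<psi>)"
      using m[of \<tau>] by (auto intro!: continuous_on_subset[OF Hc] \<phi> \<psi>)
    have "I \<phi> (m \<tau>) - I \<psi> (m \<tau>) = integral {0..m \<tau>} (\<lambda>s. H \<phi> s - H \<psi> s)"
      unfolding I_def using c' by (simp add: integral_diff integrable_continuous_interval)
    also have "norm \<dots> \<le> ((\<rho> + g / 2) * d) * m \<tau> ^ (n + 1) / real (n + 1)"
    proof (rule norm_integral_power_le)
      fix x assume "x \<in> {0..m \<tau>}"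
      then show "norm (H \<phi> x - H \<psi> x) \<le> (\<rho> + g / 2) * d * x ^ n"
        using Hd[of x] m[of \<tau>] by auto
    qed (use c' m[of \<tau>] in \<open>auto intro!: continuous_intros\<close>)
    also have "\<dots> = c * d * m \<tau> ^ (n + 1)" by (simp add: c_def)
    finally have "norm (I \<phi> (m \<tau>) - I \<psi> (m \<tau>)) / m \<tau> ^ (n + 1) \<le> c * d"
      using m(2)[of \<tau>] by (simp only: pos_divide_le_eq zero_less_power)
    moreover have "F \<phi> \<tau> - F \<psi> \<tau> = (1 / m \<tau> ^ (n + 1)) *\<^sub>R (I \<phi> (m \<tau>) - I \<psi> (m \<tau>))"
      by (simp only: F_def scaleR_right_diff_distrib)
    ultimately have "norm (F \<phi> \<tau> - F \<psi> \<tau>) \<le> c * d"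
      using m(2)[of \<tau>] by simp
    then show "dist (apply_bcontfun (T \<phi>) \<tau>) (apply_bcontfun (T \<psi>) \<tau>) \<le> c * dist \<phi> \<psi>"
      by (simp add: T \<phi> \<psi> dist_norm d_def)
  qed
  have "\<exists>!\<phi>\<in>X. T \<phi> = \<phi>"
  proof (rule Banach_fix[OF _ _ c TX])
    show "complete X" by (simp add: X_def complete_eq_closed)
    show "X \<noteq> {}" using b by (auto simp: X_def)
  qed (use contr in auto)
  then obtain \<phi> where \<phi>: "\<phi> \<in> X" "T \<phi> = \<phi>" by auto
  have WI: "W \<phi> s = (1 / s ^ n) *\<^sub>R I \<phi> s" if "s \<in> {0<..S}" for s
  proof -
    have "m (ln s) = s" using that by (auto simp: m_def)
    then have "apply_bcontfun \<phi> (ln s) = (1 / s ^ (n + 1)) *\<^sub>R I \<phi> s"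
      using T[OF \<phi>(1)] \<phi>(2) by (simp add: F_def)
    then show ?thesis using that by (simp add: W_def)
  qed
  show ?thesis
  proof (rule that)
    show "0 < S" "S \<le> S0" by (fact S)+
    show "W \<phi> 0 = 0" by (simp add: W_def)
    show "W \<phi> ` {0..S} \<subseteq> cball 0 r" using Wr[OF \<phi>(1)] by blast
    show "continuous_on {0..S} (W \<phi>)"
      unfolding continuous_on_eq_continuous_within
    proof
      fix s assume s: "s \<in> {0..S}"
      show "continuous (at s within {0..S}) (W \<phi>)"
      proof (cases "s = 0")
        case True
        have "((\<lambda>s. s * b) \<longlongrightarrow> 0) (at 0 within {0..S})"
          by (rule tendsto_eq_intros refl | simp)+
        then have "(W \<phi> \<longlongrightarrow> 0) (at 0 within {0..S})"
          by (rule Lim_null_comparison[rotated])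
             (use Wn[OF \<phi>(1)] in \<open>auto simp: eventually_at_filter\<close>)
        moreover have "W \<phi> 0 = 0" by (simp add: W_def)
        ultimately show ?thesis using True by (simp add: continuous_within)
      next
        case False
        then have "continuous (at s within {0<..S}) (W \<phi>)"
          using Wc[of \<phi>] s by (simp add: continuous_on_eq_continuous_within)
        moreover have "at s within {0<..S} = at s within {0..S}"
          using False s by (intro at_within_nhd[of s "{0<..}"]) auto
        ultimately show ?thesis by (simp add: continuous_within)
      qed
    qed
    fix s assume s: "s \<in> {0<..<S}"
    have "(I \<phi> has_vector_derivative H \<phi> s) (at s within {0..S})"
      unfolding I_def using s by (intro integral_has_vector_derivative Hc \<phi>) auto
    moreover have "at s within {0..S} = at s"
      using s by (intro at_within_interior) auto
    ultimately have ID: "(I \<phi> has_vector_derivative H \<phi> s) (at s)" by simp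
    have "((\<lambda>s. 1 / s ^ n) has_vector_derivative - (real n / s ^ (n + 1))) (at s)"
    proof -
      have "((\<lambda>s. 1 / s ^ n) has_real_derivative - (real n * s ^ (n - 1)) / (s ^ n * s ^ n)) (at s)"
        using s by (auto intro!: derivative_eq_intros)
      moreover have "- (real n * s ^ (n - 1)) / (s ^ n * s ^ n) = - (real n / s ^ (n + 1))"
        using s n pw[of s] by (simp add: field_simps)
      ultimately show ?thesis by (simp add: has_real_derivative_iff_has_vector_derivative)
    qed
    from has_vector_derivative_scaleR[OF this[folded has_real_derivative_iff_has_vector_derivative] ID]
    have "((\<lambda>s. (1 / s ^ n) *\<^sub>R I \<phi> s) has_vector_derivative
           (1 / s ^ n) *\<^sub>R H \<phi> s + (- (real n / s ^ (n + 1))) *\<^sub>R I \<phi> s) (at s)" .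
    moreover have "(1 / s ^ n) *\<^sub>R H \<phi> s + (- (real n / s ^ (n + 1))) *\<^sub>R I \<phi> s
        = (1 / s) *\<^sub>R (R (W \<phi> s) - real n *\<^sub>R W \<phi> s) + P s (W \<phi> s)"
    proof -
      have "(1 / s ^ n) * s ^ (n - 1) = 1 / s" using s pw[of s] by (simp add: field_simps)
      then have "(1 / s ^ n) *\<^sub>R H \<phi> s = (1 / s) *\<^sub>R (R (W \<phi> s) + s *\<^sub>R P s (W \<phi> s))"
        by (simp only: H_def scaleR_scaleR)
      moreover have "(- (real n / s ^ (n + 1))) *\<^sub>R I \<phi> s = - (1 / s) *\<^sub>R (real n *\<^sub>R W \<phi> s)"
        using s WI[of s] by simp
      ultimately show ?thesis using s by (simp add: scaleR_right_distrib scaleR_right_diff_distrib)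
    qed
    ultimately have "((\<lambda>s. (1 / s ^ n) *\<^sub>R I \<phi> s) has_vector_derivative
        (1 / s) *\<^sub>R (R (W \<phi> s) - real n *\<^sub>R W \<phi> s) + P s (W \<phi> s)) (at s)" by simp
    then show "(W \<phi> has_vector_derivative
        (1 / s) *\<^sub>R (R (W \<phi> s) - real n *\<^sub>R W \<phi> s) + P s (W \<phi> s)) (at s)"
      by (rule has_vector_derivative_transform_within_open[of _ _ _ "{0<..<S}"])
         (use s WI in auto)
  qed
qed

section \<open>Linearisation at the self-similar expansion\<close>

type_synonym triple = "complex \<times> complex \<times> complex"

text \<open>A contraction compares two arbitrary points near \<open>a\<close>, so the remainder must
  have a small Lipschitz constant. Its derivative at \<open>x\<close> has the coefficients of the
  derivative of \<open>f\<close> minus their values at \<open>a\<close>, each below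
  \<open>e / 2\<close> near \<open>a\<close>, and the mean value inequality applies.\<close>

lemma C1_remainder_lipschitz:
  fixes f :: "complex \<times> complex \<Rightarrow> complex"
  assumes "open U" "a \<in> U"
    and der: "\<And>x. x \<in> U \<Longrightarrow> (f has_derivative (\<lambda>h. \<alpha> x * fst h + \<beta> x * snd h)) (at x)"
    and cont: "isCont \<alpha> a" "isCont \<beta> a" and "e > 0"
  obtains d where "d > 0" "ball a d \<subseteq> U"
    "\<And>x y. x \<in> ball a d \<Longrightarrow> y \<in> ball a d \<Longrightarrow>
       norm (f x - f y - (\<alpha> a * fst (x - y) + \<beta> a * snd (x - y))) \<le> e * norm (x - y)"
proof -
  obtain d0 where d0: "d0 > 0" "ball a d0 \<subseteq> U"
    using assms(1,2) by (meson open_contains_ball)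
  obtain d1 where d1: "d1 > 0" "\<And>x. dist x a < d1 \<Longrightarrow> dist (\<alpha> x) (\<alpha> a) < e / 2"
    using cont(1) \<open>e > 0\<close> unfolding continuous_at_eps_delta by (meson half_gt_zero)
  obtain d2 where d2: "d2 > 0" "\<And>x. dist x a < d2 \<Longrightarrow> dist (\<beta> x) (\<beta> a) < e / 2"
    using cont(2) \<open>e > 0\<close> unfolding continuous_at_eps_delta by (meson half_gt_zero)
  define d where "d = min d0 (min d1 d2)"
  have d: "d > 0" "ball a d \<subseteq> U" using d0 d1 d2 by (auto simp: d_def)
  define F where "F = (\<lambda>x. f x - (\<alpha> a * fst x + \<beta> a * snd x))"
  show ?thesis
  proof (rule that[OF d])
    fix x y assume xy: "x \<in> ball a d" "y \<in> ball a d"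
    have "norm (F x - F y) \<le> e * norm (x - y)"
    proof (rule differentiable_bound[of "ball a d"])
      fix x assume x: "x \<in> ball a d"
      have "(F has_derivative (\<lambda>h. (\<alpha> x - \<alpha> a) * fst h + (\<beta> x - \<beta> a) * snd h)) (at x)"
        unfolding F_def using x d
        by (auto intro!: derivative_eq_intros der simp: algebra_simps)
      then show "(F has_derivative (\<lambda>h. (\<alpha> x - \<alpha> a) * fst h + (\<beta> x - \<beta> a) * snd h)) (at x within ball a d)"
        by (rule has_derivative_at_withinI)
      have le: "norm (\<alpha> x - \<alpha> a) \<le> e / 2" "norm (\<beta> x - \<beta> a) \<le> e / 2"
        using d1(2)[of x] d2(2)[of x] x by (auto simp: d_def dist_norm norm_minus_commute dist_commute)
      show "onorm (\<lambda>h. (\<alpha> x - \<alpha> a) * fst h + (\<beta> x - \<beta> a) * snd h) \<le> e"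
      proof (rule onorm_bound)
        fix h :: "complex \<times> complex"
        have "norm ((\<alpha> x - \<alpha> a) * fst h + (\<beta> x - \<beta> a) * snd h)
            \<le> norm (\<alpha> x - \<alpha> a) * norm (fst h) + norm (\<beta> x - \<beta> a) * norm (snd h)"
          by (metis norm_mult norm_triangle_ineq)
        also have "\<dots> \<le> e / 2 * norm h + e / 2 * norm h"
          using le norm_fst_le[of "fst h" "snd h"] norm_snd_le[of "snd h" "fst h"] \<open>e > 0\<close>
          by (intro add_mono mult_mono) auto
        finally show "norm ((\<alpha> x - \<alpha> a) * fst h + (\<beta> x - \<beta> a) * snd h) \<le> e * norm h" by simp
      qed (use \<open>e > 0\<close> in simp)
    qed (use xy in auto)
    then show "norm (f x - f y - (\<alpha> a * fst (x - y) + \<beta> a * snd (x - y))) \<le> e * norm (x - y)"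
      by (simp add: F_def algebra_simps)
  qed
qed

text \<open>
  With \<open>d = z\<^sub>2 - z\<^sub>3\<close> and \<open>z\<^sub>2 + z\<^sub>3 - 2 z\<^sub>1 = sqrt (3/2) S\<close> the pair interaction becomes a rational function
  of \<open>(S, d)\<close> with rational coefficients: these are the conjugated velocities of \<open>d\<close> and \<open>S\<close>, up to a
  common factor. A pair \<open>(S, d)\<close> moves self-similarly iff \<open>2 |d|\<^sup>2 = |S|\<^sup>2\<close>; the one used below is
  \<open>(1 - i, 1)\<close>, which expands like \<open>s exp (3 i ln s)\<close> in the time \<open>s = sqrt t\<close>.
\<close>

definition interaction_d :: "complex \<times> complex \<Rightarrow> complex" where
  "interaction_d p = 4 * snd p / (3/2 * fst p ^ 2 - snd p ^ 2) + 4 / snd p"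

definition interaction_s :: "complex \<times> complex \<Rightarrow> complex" where
  "interaction_s p = 12 * fst p / (3/2 * fst p ^ 2 - snd p ^ 2)"

definition noncollision :: "(complex \<times> complex) set" where
  "noncollision = {p. 3/2 * fst p ^ 2 - snd p ^ 2 \<noteq> 0 \<and> snd p \<noteq> 0}"

lemma open_noncollision: "open noncollision"
  unfolding noncollision_def by (intro open_Collect_conj open_Collect_neq continuous_intros)

lemma interaction_d_deriv:
  assumes "p \<in> noncollision"
  shows "(interaction_d has_derivative (\<lambda>h.
     (- 12 * fst p * snd p / (3/2 * fst p ^ 2 - snd p ^ 2)^2) * fst h +
     (4 * (3/2 * fst p ^ 2 + snd p ^ 2) / (3/2 * fst p ^ 2 - snd p ^ 2)^2 - 4 / snd p ^ 2) * snd h)) (at p)"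
proof -
  have nz: "3/2 * fst p ^ 2 - snd p ^ 2 \<noteq> 0" "snd p \<noteq> 0" using assms by (auto simp: noncollision_def)
  define Q where "Q = 3/2 * fst p ^ 2 - snd p ^ 2"
  show ?thesis
    unfolding interaction_d_def[abs_def]
    apply (rule has_derivative_eq_rhs)
     apply (rule derivative_intros refl nz)+
    using nz
    apply (simp add: fun_eq_iff flip: Q_def)
    apply (intro allI)
    apply (simp add: divide_simps)
    apply (simp add: Q_def power2_eq_square)
    apply algebra
    done
qed

lemma interaction_s_deriv:
  assumes "p \<in> noncollision"
  shows "(interaction_s has_derivative (\<lambda>h.
     (- 12 * (3/2 * fst p ^ 2 + snd p ^ 2) / (3/2 * fst p ^ 2 - snd p ^ 2)^2) * fst h +
     (24 * fst p * snd p / (3/2 * fst p ^ 2 - snd p ^ 2)^2) * snd h)) (at p)"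
proof -
  have nz: "3/2 * fst p ^ 2 - snd p ^ 2 \<noteq> 0" "snd p \<noteq> 0" using assms by (auto simp: noncollision_def)
  define Q where "Q = 3/2 * fst p ^ 2 - snd p ^ 2"
  show ?thesis
    unfolding interaction_s_def[abs_def]
    apply (rule has_derivative_eq_rhs)
     apply (rule derivative_intros refl nz)+
    using nz
    apply (simp add: fun_eq_iff flip: Q_def)
    apply (intro allI)
    apply (simp add: divide_simps)
    apply (simp add: Q_def power2_eq_square)
    apply algebra
    done
qed

text \<open>
  The linearisation at \<open>(1 - i, 1)\<close> of the flow in the rescaled rotating frame has the eigenvalues \<open>0\<close>
  (rotation and energy), \<open>- 2\<close> (dilation and virial) and \<open>- 1 \<plusminus> 3 i\<close> (centre of vorticity). The real
  coordinates below triangularise it: \<open>coordA\<close> spans the rotation and the dilation eigenvector,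
  \<open>coordB\<close> the energy and the virial direction. The factor \<open>1/10\<close> makes the off-diagonal entries
  small, so that the linearisation plus \<open>4\<close> has norm below \<open>5\<close>.
\<close>

definition coordA :: "complex \<Rightarrow> complex" where
  "coordA w = \<i> * of_real (Re w) + (1 + 3 * \<i>) * of_real (Im w)"
definition coordA' :: "complex \<Rightarrow> complex" where
  "coordA' v = Complex (Im v - 3 * Re v) (Re v)"
definition coordB :: "complex \<Rightarrow> complex" where
  "coordB w = (1 + \<i>) / 10 * of_real (Re w) + (2 + \<i>) / 10 * of_real (Im w)"
definition coordB' :: "complex \<Rightarrow> complex" where
  "coordB' v = 10 * Complex (2 * Im v - Re v) (Re v - Im v)"

lemma coord_inverse [simp]: "coordA (coordA' v) = v" "coordB (coordB' v) = v"
  by (simp_all add: coordA_def coordA'_def coordB_def coordB'_def complex_eq_iff field_simps)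

lemma Complex_bounded_linear:
  assumes "bounded_linear f" "bounded_linear g"
  shows "bounded_linear (\<lambda>x. Complex (f x) (g x))"
proof -
  have "bounded_linear (\<lambda>x. complex_of_real (f x) + \<i> * complex_of_real (g x))"
    using assms by (intro bounded_linear_intros bounded_linear_compose[OF bounded_linear_of_real])
  then show ?thesis by (simp add: Complex_eq)
qed

lemma bounded_linear_coord:
  assumes "bounded_linear f"
  shows "bounded_linear (\<lambda>x. coordA (f x))" "bounded_linear (\<lambda>x. coordB (f x))"
    "bounded_linear (\<lambda>x. coordA' (f x))" "bounded_linear (\<lambda>x. coordB' (f x))"
  unfolding coordA_def coordA'_def coordB_def coordB'_def
  by (intro bounded_linear_intros Complex_bounded_linear assms
        bounded_linear_compose[OF bounded_linear_of_real]
        bounded_linear_compose[OF bounded_linear_Re] bounded_linear_compose[OF bounded_linear_Im])+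

text \<open>The equilibrium is \<open>w = 0\<close>. The first coordinate multiplies
  \<open>S\<close> and \<open>d\<close> by a common complex factor, a rotation and dilation; the
  second is the shape deformation S - (1 - i) d. The centre of vorticity is kept in the
  third.\<close>

definition config :: "triple \<Rightarrow> complex \<times> complex" where
  "config w = ((1 - \<i>) * (1 + coordA (fst w)) + coordB (fst (snd w)), 1 + coordA (fst w))"

text \<open>The term with 1 + 3 i removes the motion of the frame s exp (3 i ln s). The factor 5 i /
  6 is what remains of the interaction strength once lengths are scaled so that d = 1 at
  equilibrium.\<close>

definition field_d :: "triple \<Rightarrow> complex" where
  "field_d w = - (1 + 3 * \<i>) * snd (config w) + 5 * \<i> / 6 * cnj (interaction_d (config w))"

definition field_s :: "triple \<Rightarrow> complex" where
  "field_s w = - (1 + 3 * \<i>) * fst (config w) + 5 * \<i> / 6 * cnj (interaction_s (config w))"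

text \<open>This is \<open>R\<close> of the singular equation for n = 4: the rescaled flow plus 4
  times the identity. The centre of vorticity feels only the frame, hence 4 - (1 + 3 i) = 3 - 3
  i.\<close>

definition shifted_field :: "triple \<Rightarrow> triple" where
  "shifted_field w = (coordA' (field_d w) + 4 * fst w,
      coordB' (field_s w - (1 - \<i>) * field_d w) + 4 * fst (snd w),
      (3 - 3 * \<i>) * snd (snd w))"

text \<open>The relative equilibrium equation: 5 i / 6 times the conjugated interaction at (1 - i,
  1) equals 1 + 3 i times that pair.\<close>

lemma shifted_field_0: "shifted_field 0 = 0"
  by (simp add: shifted_field_def field_d_def field_s_def config_def interaction_d_def interaction_s_def coordA_def coordB_def
      coordA'_def coordB'_def complex_eq_iff zero_prod_def power2_eq_square Re_divide Im_divide)

definition config_lin :: "triple \<Rightarrow> complex \<times> complex" where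
  "config_lin w = ((1 - \<i>) * coordA (fst w) + coordB (fst (snd w)), coordA (fst w))"

lemma config_lin: "bounded_linear config_lin" "config u - config v = config_lin (u - v)"
proof -
  show "bounded_linear config_lin" unfolding config_lin_def
    by (intro bounded_linear_Pair bounded_linear_add bounded_linear_const_mult bounded_linear_coord
      bounded_linear_intros)
  show "config u - config v = config_lin (u - v)"
    by (simp add: config_def config_lin_def coordA_def coordB_def field_simps complex_eq_iff)
qed

text \<open>The derivative of \<open>shifted_field\<close> at 0. On the first two components the
  double eigenvalues 4 and 2 both have Jordan blocks, so the off-diagonal entries can be scaled down
  but not removed altogether.\<close>

definition linearization :: "triple \<Rightarrow> triple" where
  "linearization h = (Complex (4 * Re (fst h) - Re (fst (snd h)) / 5)
               (2 * Im (fst h) + Im (fst (snd h)) / 10 + 3 / 25 * Re (fst (snd h))),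
             Complex (4 * Re (fst (snd h))) (2 * Im (fst (snd h))), (3 - 3 * \<i>) * snd (snd h))"

text \<open>The diagonal part has norm sqrt 18 < 17/4, attained by 3 - 3 i, and the off-diagonal
  entries 1/5, 1/10 and 3/25 add less than 1/2.\<close>

lemma norm_linearization: "norm (linearization h) \<le> 19 / 4 * norm h"
proof -
  obtain a b c where h: "h = (a, b, c)" by (cases h)
  have e: "linearization h = (Complex (4 * Re a) (2 * Im a), Complex (4 * Re b) (2 * Im b), (3 - 3 * \<i>) * c)
     + (Complex (- Re b / 5) (Im b / 10 + 3 / 25 * Re b), 0, 0)"
    by (simp add: h linearization_def complex_eq_iff)
  have n1: "norm (Complex (4 * Re z) (2 * Im z)) ^ 2 \<le> 18 * norm z ^ 2" for z
    unfolding cmod_power2 by (simp add: power2_eq_square)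
  have "norm (3 - 3 * \<i>) ^ 2 = 18" unfolding cmod_power2 by simp
  then have n2: "norm ((3 - 3 * \<i>) * c) ^ 2 = 18 * norm c ^ 2"
    by (simp add: norm_mult power_mult_distrib)
  have "norm (Complex (4 * Re a) (2 * Im a), Complex (4 * Re b) (2 * Im b), (3 - 3 * \<i>) * c)
      \<le> sqrt (18 * norm h ^ 2)"
    unfolding h norm_Pair
    by (rule real_sqrt_le_mono) (use n1[of a] n1[of b] n2 in simp)
  also have "\<dots> \<le> 17 / 4 * norm h"
    by (rule real_le_lsqrt) (auto simp: power_mult_distrib power_divide)
  finally have A: "norm (Complex (4 * Re a) (2 * Im a), Complex (4 * Re b) (2 * Im b), (3 - 3 * \<i>) * c)
      \<le> 17 / 4 * norm h" .
  have "norm (Complex (- Re b / 5) (Im b / 10 + 3 / 25 * Re b))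
      \<le> \<bar>- Re b / 5\<bar> + \<bar>Im b / 10 + 3 / 25 * Re b\<bar>"
    using cmod_le[of "Complex (- Re b / 5) (Im b / 10 + 3 / 25 * Re b)"] by simp
  also have "\<dots> \<le> 1 / 2 * norm b"
    using abs_Re_le_cmod[of b] abs_Im_le_cmod[of b] by linarith
  also have "\<dots> \<le> 1 / 2 * norm h"
    using norm_snd_le[of "(b, c)" a] norm_fst_le[of b c] by (simp add: h)
  finally have "norm (Complex (- Re b / 5) (Im b / 10 + 3 / 25 * Re b), 0::complex, 0::complex) \<le> 1 / 2 * norm h"
    by (simp add: norm_Pair)
  from norm_triangle_mono[OF A this] show ?thesis unfolding e by simp
qed

definition interaction_coords :: "complex \<times> complex \<Rightarrow> triple" where
  "interaction_coords p = (coordA' (5 * \<i> / 6 * cnj (snd p)),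
     coordB' (5 * \<i> / 6 * cnj (fst p) - (1 - \<i>) * (5 * \<i> / 6 * cnj (snd p))), 0)"

lemma bounded_linear_interaction_coords: "bounded_linear interaction_coords"
  unfolding interaction_coords_def
  by (intro bounded_linear_Pair bounded_linear_coord bounded_linear_sub bounded_linear_zero
      bounded_linear_intros bounded_linear_compose[OF bounded_linear_cnj])

lemma linearization_eq:
  "linearization h = interaction_coords ((78 - 54 * \<i>) / 25 * fst (config_lin h) + (- 84 + 12 * \<i>) / 25 * snd (config_lin h),
                (42 - 6 * \<i>) / 25 * fst (config_lin h) + (- 126 + 18 * \<i>) / 25 * snd (config_lin h))
     + (coordA' (- (1 + 3 * \<i>) * snd (config_lin h)) + 4 * fst h,
        coordB' (- (1 + 3 * \<i>) * (fst (config_lin h) - (1 - \<i>) * snd (config_lin h))) + 4 * fst (snd h),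
        (3 - 3 * \<i>) * snd (snd h))"
  by (simp add: linearization_def interaction_coords_def config_lin_def coordA_def coordB_def coordA'_def coordB'_def
      complex_eq_iff field_simps)

text \<open>The only nonlinearity is in the two interaction functions and enters through a linear
  map, so the whole remainder is the image of theirs. The numerical coefficients are their partial
  derivatives at (1 - i, 1).\<close>

lemma shifted_field_diff:
  "shifted_field u - shifted_field v = linearization (u - v)
     + interaction_coords (interaction_s (config u) - interaction_s (config v) - ((78 - 54 * \<i>) / 25 * fst (config u - config v) + (- 84 + 12 * \<i>) / 25 * snd (config u - config v)),
             interaction_d (config u) - interaction_d (config v) - ((42 - 6 * \<i>) / 25 * fst (config u - config v) + (- 126 + 18 * \<i>) / 25 * snd (config u - config v)))"
    (is "_ = _ + interaction_coords (?Gs - ?Ls, ?Gd - ?Ld)")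
proof -
  interpret bounded_linear interaction_coords by (rule bounded_linear_interaction_coords)
  have "shifted_field u - shifted_field v = interaction_coords (?Gs, ?Gd)
     + (coordA' (- (1 + 3 * \<i>) * snd (config u - config v)) + 4 * fst (u - v),
        coordB' (- (1 + 3 * \<i>) * (fst (config u - config v) - (1 - \<i>) * snd (config u - config v))) + 4 * fst (snd (u - v)),
        (3 - 3 * \<i>) * snd (snd (u - v)))"
    by (simp add: shifted_field_def field_d_def field_s_def interaction_coords_def coordA'_def coordB'_def complex_eq_iff)
       (simp add: field_simps)
  moreover have "interaction_coords (?Gs - ?Ls, ?Gd - ?Ld) = interaction_coords (?Gs, ?Gd) - interaction_coords (?Ls, ?Ld)"
    using diff[of "(?Gs, ?Gd)" "(?Ls, ?Ld)"] by simp
  moreover have "linearization (u - v) = interaction_coords (?Ls, ?Ld)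
     + (coordA' (- (1 + 3 * \<i>) * snd (config u - config v)) + 4 * fst (u - v),
        coordB' (- (1 + 3 * \<i>) * (fst (config u - config v) - (1 - \<i>) * snd (config u - config v))) + 4 * fst (snd (u - v)),
        (3 - 3 * \<i>) * snd (snd (u - v)))"
    unfolding config_lin(2) by (rule linearization_eq)
  ultimately show ?thesis by simp
qed

lemma shifted_field_lipschitz:
  obtains r where "r > 0" "\<And>u. u \<in> cball 0 r \<Longrightarrow> config u \<in> noncollision"
    "\<And>u v. u \<in> cball 0 r \<Longrightarrow> v \<in> cball 0 r \<Longrightarrow> norm (shifted_field u - shifted_field v) \<le> 39 / 8 * norm (u - v)"
proof -
  define a where "a = config 0"
  have a: "a = (1 - \<i>, 1)" by (simp add: a_def config_def coordA_def coordB_def)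
  have W: "3/2 * fst a ^ 2 - snd a ^ 2 = - 1 - 3 * \<i>"
    by (simp add: a complex_eq_iff power2_eq_square)
  have W2: "(- 1 - 3 * \<i>)\<^sup>2 = - 8 + 6 * \<i>" by (simp add: complex_eq_iff power2_eq_square)
  have aU: "a \<in> noncollision" unfolding noncollision_def using W by (auto simp: a complex_eq_iff)
  then have nz: "3/2 * fst a ^ 2 - snd a ^ 2 \<noteq> 0" "snd a \<noteq> 0" by (auto simp: noncollision_def)
  obtain K where K: "K > 0" "\<And>x. norm (config_lin x) \<le> norm x * K"
    using bounded_linear.pos_bounded[OF config_lin(1)] by blast
  obtain G where G: "G > 0" "\<And>x. norm (interaction_coords x) \<le> norm x * G"
    using bounded_linear.pos_bounded[OF bounded_linear_interaction_coords] by blast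
  \<comment> \<open>The two remainders contribute 2 e K G = 1/8 in total, and 19/4 + 1/8 = 39/8 is
    still below 5.\<close>
  define e where "e = 1 / (16 * K * G)"
  have e: "e > 0" using K G by (simp add: e_def)
  obtain r1 where r1: "r1 > 0" "ball a r1 \<subseteq> noncollision" "\<And>x y. x \<in> ball a r1 \<Longrightarrow> y \<in> ball a r1 \<Longrightarrow>
       norm (interaction_d x - interaction_d y - ((- 12 * fst a * snd a / (3/2 * fst a ^ 2 - snd a ^ 2)^2) * fst (x - y)
        + (4 * (3/2 * fst a ^ 2 + snd a ^ 2) / (3/2 * fst a ^ 2 - snd a ^ 2)^2 - 4 / snd a ^ 2) * snd (x - y)))
       \<le> e * norm (x - y)"
    by (rule C1_remainder_lipschitz[OF open_noncollision aU interaction_d_deriv _ _ e])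
       (use nz in \<open>auto intro!: continuous_intros\<close>)
  obtain r2 where r2: "r2 > 0" "ball a r2 \<subseteq> noncollision" "\<And>x y. x \<in> ball a r2 \<Longrightarrow> y \<in> ball a r2 \<Longrightarrow>
       norm (interaction_s x - interaction_s y - ((- 12 * (3/2 * fst a ^ 2 + snd a ^ 2) / (3/2 * fst a ^ 2 - snd a ^ 2)^2) * fst (x - y)
        + (24 * fst a * snd a / (3/2 * fst a ^ 2 - snd a ^ 2)^2) * snd (x - y)))
       \<le> e * norm (x - y)"
    by (rule C1_remainder_lipschitz[OF open_noncollision aU interaction_s_deriv _ _ e])
       (use nz in \<open>auto intro!: continuous_intros\<close>)
  have coef: "- 12 * fst a * snd a / (3/2 * fst a ^ 2 - snd a ^ 2)^2 = (42 - 6 * \<i>) / 25"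
    "4 * (3/2 * fst a ^ 2 + snd a ^ 2) / (3/2 * fst a ^ 2 - snd a ^ 2)^2 - 4 / snd a ^ 2 = (- 126 + 18 * \<i>) / 25"
    "- 12 * (3/2 * fst a ^ 2 + snd a ^ 2) / (3/2 * fst a ^ 2 - snd a ^ 2)^2 = (78 - 54 * \<i>) / 25"
    "24 * fst a * snd a / (3/2 * fst a ^ 2 - snd a ^ 2)^2 = (- 84 + 12 * \<i>) / 25"
    unfolding W W2
    by (simp_all add: a complex_eq_iff power2_eq_square Re_divide Im_divide)
  define r where "r = min r1 r2 / (2 * K)"
  have r: "r > 0" using r1 r2 K by (simp add: r_def)
  have sdb: "config u \<in> ball a r1" "config u \<in> ball a r2" if "u \<in> cball 0 r" for u
  proof -
    have "norm (config u - a) \<le> norm u * K" using K(2)[of u] by (simp add: a_def config_lin(2))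
    also have "\<dots> \<le> r * K" using that K by (intro mult_right_mono) auto
    also have "\<dots> = min r1 r2 / 2" using K(1) by (simp add: r_def)
    also have "\<dots> < min r1 r2" using r1(1) r2(1) by linarith
    finally show "config u \<in> ball a r1" "config u \<in> ball a r2"
      by (auto simp: dist_norm norm_minus_commute)
  qed
  show ?thesis
  proof (rule that[OF r])
    show "config u \<in> noncollision" if "u \<in> cball 0 r" for u using sdb[OF that] r1(2) by blast
    fix u v :: "triple"
    assume u: "u \<in> cball 0 r" and v: "v \<in> cball 0 r"
    let ?x = "interaction_s (config u) - interaction_s (config v) - ((78 - 54 * \<i>) / 25 * fst (config u - config v) + (- 84 + 12 * \<i>) / 25 * snd (config u - config v))"
    let ?y = "interaction_d (config u) - interaction_d (config v) - ((42 - 6 * \<i>) / 25 * fst (config u - config v) + (- 126 + 18 * \<i>) / 25 * snd (config u - config v))"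
    have xy: "norm ?x \<le> e * norm (config u - config v)" "norm ?y \<le> e * norm (config u - config v)"
      using r1(3)[OF sdb(1)[OF u] sdb(1)[OF v]] r2(3)[OF sdb(2)[OF u] sdb(2)[OF v]] unfolding coef by blast+
    have "norm (interaction_coords (?x, ?y)) \<le> norm (?x, ?y) * G" by (rule G(2))
    also have "\<dots> \<le> (norm ?x + norm ?y) * G"
      using G(1) by (intro mult_right_mono norm_Pair_le) auto
    also have "\<dots> \<le> (2 * e * (norm (u - v) * K)) * G"
    proof (rule mult_right_mono)
      have "norm (config u - config v) \<le> norm (u - v) * K" using K(2) by (simp add: config_lin(2))
      then have "e * norm (config u - config v) \<le> e * (norm (u - v) * K)" using e by simp
      then show "norm ?x + norm ?y \<le> 2 * e * (norm (u - v) * K)" using xy by linarith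
    qed (use G in simp)
    also have "\<dots> = 1 / 8 * norm (u - v)" using K G by (simp add: e_def)
    finally have "norm (interaction_coords (?x, ?y)) \<le> 1 / 8 * norm (u - v)" .
    then show "norm (shifted_field u - shifted_field v) \<le> 39 / 8 * norm (u - v)"
      unfolding shifted_field_diff using norm_linearization[of "u - v"] norm_triangle_ineq[of "linearization (u - v)" "interaction_coords (?x, ?y)"]
      by linarith
  qed
qed

section \<open>Bursting solutions for a Lipschitz perturbation\<close>

definition cscale :: "complex \<Rightarrow> triple \<Rightarrow> triple" where
  "cscale c p = (c * fst p, c * fst (snd p), c * snd (snd p))"
definition cnj3 :: "triple \<Rightarrow> triple" where
  "cnj3 p = (cnj (fst p), cnj (fst (snd p)), cnj (snd (snd p)))"
text \<open>The pair sum for the normalised intensities -1, 2, 2. Conjugation and the factor i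
  \<kappa> with \<kappa> = \<xi> / (6 pi), that is \<xi> / 3 over 2 pi, are applied outside.\<close>

definition interaction :: "triple \<Rightarrow> triple" where
  "interaction z = (let a = fst z; b = fst (snd z); c = snd (snd z) in
     (2 / (a - b) + 2 / (a - c), - 1 / (b - a) + 2 / (b - c), - 1 / (c - a) + 2 / (c - b)))"
definition distinct3 :: "triple \<Rightarrow> bool" where
  "distinct3 z \<longleftrightarrow> fst z \<noteq> fst (snd z) \<and> fst z \<noteq> snd (snd z) \<and> fst (snd z) \<noteq> snd (snd z)"

lemma norm_cscale: "norm (cscale c p) = norm c * norm p"
proof -
  obtain x y z where "p = (x, y, z)" by (cases p)
  then show ?thesis
    by (simp add: cscale_def norm_Pair norm_mult power_mult_distrib flip: distrib_left)
       (simp add: real_sqrt_mult)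
qed

lemma bounded_bilinear_cscale: "bounded_bilinear cscale"
proof
  show "\<exists>K. \<forall>a b. norm (cscale a b) \<le> norm a * norm b * K"
    by (rule exI[of _ 1]) (simp add: norm_cscale)
qed (simp_all add: cscale_def algebra_simps)

lemma cscale_cscale [simp]: "cscale a (cscale b p) = cscale (a * b) p" by (simp add: cscale_def mult_ac)
lemma scaleR_eq_cscale: "r *\<^sub>R p = cscale (of_real r) p"
  by (simp add: cscale_def scaleR_prod_def scaleR_conv_of_real)

lemma interaction_cscale: "interaction (z + cscale c v) = cscale (1 / c) (interaction v)" if "fst z = fst (snd z)" "fst z = snd (snd z)"
  using that unfolding interaction_def cscale_def Let_def
  by (simp add: add_divide_distrib diff_divide_distrib distrib_left flip: right_diff_distrib) (simp add: mult.commute)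

lemma distinct3_cscale: "distinct3 (z + cscale c v) \<longleftrightarrow> distinct3 v"
  if "fst z = fst (snd z)" "fst z = snd (snd z)" "c \<noteq> 0"
  using that by (auto simp: distinct3_def cscale_def)

text \<open>Positions in terms of \<open>((S, d), C)\<close>, where \<open>C\<close> is the centre of vorticity \<open>(- z\<^sub>1 + 2 z\<^sub>2 + 2 z\<^sub>3) / 3\<close>.\<close>

definition vortex_triple :: "(complex \<times> complex) \<times> complex \<Rightarrow> triple" where
  "vortex_triple q = (snd q - 2/3 * (of_real (sqrt (3/2)) * fst (fst q)),
                snd q - 1/6 * (of_real (sqrt (3/2)) * fst (fst q)) + 1/2 * snd (fst q),
                snd q - 1/6 * (of_real (sqrt (3/2)) * fst (fst q)) - 1/2 * snd (fst q))"

definition positions :: "triple \<Rightarrow> triple" where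
  "positions w = vortex_triple (config w, snd (snd w))"
definition positions_lin :: "triple \<Rightarrow> triple" where
  "positions_lin w = vortex_triple (config_lin w, snd (snd w))"
text \<open>The inverse of \<open>positions_lin\<close>, used to pull a velocity of the vortices
  back to the adapted coordinates.\<close>

definition velocity_coords :: "triple \<Rightarrow> triple" where
  "velocity_coords e = (let a = fst e; b = fst (snd e); c = snd (snd e) in
     (coordA' (b - c),
      coordB' (of_real (sqrt (2/3)) * (b + c - 2 * a) - (1 - \<i>) * (b - c)),
      1/3 * (- a + 2 * b + 2 * c)))"

lemma bounded_linear_vortex_triple: "bounded_linear vortex_triple"
  unfolding vortex_triple_def
  by (intro bounded_linear_Pair bounded_linear_sub bounded_linear_add bounded_linear_const_mult
      bounded_linear_compose[OF bounded_linear_fst] bounded_linear_compose[OF bounded_linear_snd]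
      bounded_linear_fst bounded_linear_snd)

lemma bounded_linear_positions_lin: "bounded_linear positions_lin"
  unfolding positions_lin_def
  by (intro bounded_linear_compose[OF bounded_linear_vortex_triple] bounded_linear_Pair config_lin
      bounded_linear_compose[OF bounded_linear_snd] bounded_linear_snd)

lemma bounded_linear_velocity_coords: "bounded_linear velocity_coords"
  unfolding velocity_coords_def Let_def
  by (intro bounded_linear_Pair bounded_linear_coord bounded_linear_sub bounded_linear_add
      bounded_linear_const_mult bounded_linear_minus
      bounded_linear_compose[OF bounded_linear_fst] bounded_linear_compose[OF bounded_linear_snd]
      bounded_linear_fst bounded_linear_snd)

lemma positions_diff: "positions u - positions v = positions_lin (u - v)"
proof -
  interpret bounded_linear vortex_triple by (rule bounded_linear_vortex_triple)
  show ?thesis by (simp add: positions_def positions_lin_def diff[symmetric] config_lin(2))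
qed

lemma positions_eq: "positions_lin w + positions 0 = positions w"
  using positions_diff[of w 0] by (simp add: diff_eq_eq)

lemma sqrt_3_2: "complex_of_real (sqrt (3/2)) * complex_of_real (sqrt (2/3)) = 1"
  "complex_of_real (sqrt (3/2)) * complex_of_real (sqrt (3/2)) = 3/2"
  by (simp_all flip: of_real_mult real_sqrt_mult)

lemma positions_lin_velocity_coords: "positions_lin (velocity_coords e) = e"
proof -
  obtain a b c where e: "e = (a, b, c)" by (cases e)
  have "config_lin (velocity_coords e) = (of_real (sqrt (2/3)) * (b + c - 2 * a), b - c)"
    by (simp add: config_lin_def velocity_coords_def e)
  then have "positions_lin (velocity_coords e) = vortex_triple ((of_real (sqrt (2/3)) * (b + c - 2 * a), b - c), 1/3 * (- a + 2 * b + 2 * c))"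
    by (simp add: positions_lin_def velocity_coords_def e)
  also have "\<dots> = e"
    unfolding vortex_triple_def e fst_conv snd_conv mult.assoc[symmetric] sqrt_3_2
    by (simp add: field_simps)
  finally show ?thesis .
qed

lemma positions_distinct: "distinct3 (positions w)" if "config w \<in> noncollision"
proof -
  define t where "t = complex_of_real (sqrt (3/2))"
  have t: "t * t = 3/2" by (simp add: t_def sqrt_3_2)
  obtain S d where S: "config w = (S, d)" by fastforce
  have nz: "3/2 * S ^ 2 - d ^ 2 \<noteq> 0" "d \<noteq> 0" using that by (auto simp: S noncollision_def)
  have "3/2 * S ^ 2 - d ^ 2 = (t * S + d) * (t * S - d)"
    using t by (simp add: algebra_simps power2_eq_square)
  then have nz': "t * S + d \<noteq> 0" "t * S - d \<noteq> 0" using nz by auto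
  have "fst (snd (positions w)) - fst (positions w) = 1/2 * (t * S + d)"
    "snd (snd (positions w)) - fst (positions w) = 1/2 * (t * S - d)"
    "fst (snd (positions w)) - snd (snd (positions w)) = d"
    by (simp_all add: positions_def vortex_triple_def S t_def[symmetric] field_simps)
  then show ?thesis using nz' nz unfolding distinct3_def by fastforce
qed

lemma interaction_positions:
  assumes "config w \<in> noncollision"
  shows "interaction (positions w) = vortex_triple ((interaction_s (config w), interaction_d (config w)), 0)"
proof -
  define t where "t = complex_of_real (sqrt (3/2))"
  have t: "t * t = 3/2" by (simp add: t_def sqrt_3_2)
  obtain S d where S: "config w = (S, d)" by fastforce
  have nz: "3/2 * S ^ 2 - d ^ 2 \<noteq> 0" "d \<noteq> 0" using assms by (auto simp: S noncollision_def)
  define x where "x = t * S + d"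
  define y where "y = t * S - d"
  have xy: "3/2 * S ^ 2 - d ^ 2 = x * y"
    using t by (simp add: x_def y_def algebra_simps power2_eq_square)
  then have nz': "x \<noteq> 0" "y \<noteq> 0" using nz by auto
  have diffs: "fst (snd (positions w)) - fst (positions w) = 1/2 * x"
    "snd (snd (positions w)) - fst (positions w) = 1/2 * y"
    "fst (snd (positions w)) - snd (snd (positions w)) = d"
    by (simp_all add: positions_def vortex_triple_def S t_def[symmetric] x_def y_def field_simps)
  then have diffs': "fst (positions w) - fst (snd (positions w)) = - (1/2 * x)"
    "fst (positions w) - snd (snd (positions w)) = - (1/2 * y)"
    "snd (snd (positions w)) - fst (snd (positions w)) = - d"
    by (metis minus_diff_eq)+
  have i: "interaction (positions w) = (2 / (- (1/2 * x)) + 2 / (- (1/2 * y)), - 1 / (1/2 * x) + 2 / d,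
      - 1 / (1/2 * y) + 2 / (- d))"
    by (simp only: interaction_def Let_def diffs diffs')
  have d: "d = 1/2 * (x - y)" by (simp add: x_def y_def)
  have tS: "t * S = 1/2 * (x + y)" by (simp add: x_def y_def)
  have "t * interaction_s (S, d) = 12 * (t * S) / (3/2 * S ^ 2 - d ^ 2)" by (simp add: interaction_s_def)
  moreover have "12 * (t * S) = 6 * (x + y)" unfolding tS by simp
  ultimately have ts: "t * interaction_s (S, d) = 6 * (x + y) / (x * y)" by (simp only: xy)
  have "4 * d = 2 * (x - y)" by (simp add: d)
  then have interaction_d: "interaction_d (S, d) = 2 * (x - y) / (x * y) + 4 / d"
    by (simp only: interaction_d_def xy fst_conv snd_conv)
  show ?thesis
    unfolding i vortex_triple_def S fst_conv snd_conv t_def[symmetric] ts interaction_d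
    using nz nz' by (simp add: field_simps)
qed

text \<open>This links the abstract equation to the vortices: with the shift by 4 undone, the
  adapted field is the vortex field in the rescaled rotating frame.\<close>

lemma positions_lin_field:
  assumes "config w \<in> noncollision"
  shows "positions_lin (shifted_field w - 4 *\<^sub>R w) = cscale (- (1 + 3 * \<i>)) (positions w) + cscale (5 * \<i> / 6) (cnj3 (interaction (positions w)))"
proof -
  have "config_lin (shifted_field w - 4 *\<^sub>R w) = (field_s w, field_d w)"
    by (simp add: config_lin_def shifted_field_def scaleR_conv_of_real)
  moreover have "snd (snd (shifted_field w - 4 *\<^sub>R w)) = - (1 + 3 * \<i>) * snd (snd w)"
    by (simp add: shifted_field_def scaleR_conv_of_real algebra_simps)
  ultimately have "positions_lin (shifted_field w - 4 *\<^sub>R w) = vortex_triple ((field_s w, field_d w), - (1 + 3 * \<i>) * snd (snd w))"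
    by (simp only: positions_lin_def)
  then show ?thesis
    unfolding interaction_positions[OF assms] unfolding positions_def
    by (simp add: field_s_def field_d_def vortex_triple_def cscale_def cnj3_def) (simp add: field_simps)
qed

text \<open>The power s^(3 i). Thus \<open>s * spiral s\<close> is s^(1 + 3 i), the complex scale
  factor of the self-similar motion.\<close>

definition spiral :: "real \<Rightarrow> complex" where
  "spiral s = exp (3 * \<i> * of_real (ln s))"

lemma norm_spiral [simp]: "norm (spiral s) = 1"
  by (simp add: spiral_def norm_exp_eq_Re)

lemma spiral_nonzero [simp]: "spiral s \<noteq> 0"
  by (simp add: spiral_def)

text \<open>The interaction has degree -1 and enters conjugated. By this identity it turns with the
  frame, so the rescaled interaction has no explicit dependence on time.\<close>

lemma cnj_spiral: "cnj (1 / spiral s) = spiral s"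
  by (simp add: spiral_def exp_cnj exp_minus field_simps)

lemma spiral_deriv:
  assumes "s > 0"
  shows "((\<lambda>s. of_real s * spiral s) has_vector_derivative (1 + 3 * \<i>) * spiral s) (at s)"
proof -
  have "((\<lambda>s. complex_of_real (ln s)) has_vector_derivative of_real (1 / s)) (at s)"
    using assms by (intro has_vector_derivative_of_real) (auto intro!: derivative_eq_intros)
  then have "((\<lambda>s. 3 * \<i> * complex_of_real (ln s)) has_vector_derivative 3 * \<i> * of_real (1 / s)) (at s)"
    by (rule has_vector_derivative_mult_right)
  then have "(exp \<circ> (\<lambda>s. 3 * \<i> * complex_of_real (ln s)) has_vector_derivative
      3 * \<i> * of_real (1 / s) * exp (3 * \<i> * of_real (ln s))) (at s)"
    by (rule field_vector_diff_chain_at) (rule DERIV_exp)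
  then have "(spiral has_vector_derivative 3 * \<i> * of_real (1 / s) * spiral s) (at s)"
    by (simp add: spiral_def[abs_def] o_def)
  moreover have "((\<lambda>s. complex_of_real s) has_vector_derivative of_real 1) (at s)"
    by (intro has_vector_derivative_of_real) (auto intro!: derivative_eq_intros)
  ultimately have "((\<lambda>s. of_real s * spiral s) has_vector_derivative
      of_real s * (3 * \<i> * of_real (1 / s) * spiral s) + of_real 1 * spiral s) (at s)"
    by (rule has_vector_derivative_mult[rotated])
  then show ?thesis using assms by (simp add: field_simps)
qed

lemma vortex_burst_pos:
  fixes E :: "triple \<Rightarrow> triple" and z\<^sub>0 :: complex and \<kappa> r M :: real
  defines "Z0 \<equiv> (z\<^sub>0, z\<^sub>0, z\<^sub>0)"
  assumes "\<kappa> > 0" and "r > 0" and "M \<ge> 0"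
    and EL: "\<And>p q. p \<in> cball Z0 r \<Longrightarrow> q \<in> cball Z0 r \<Longrightarrow> norm (E p - E q) \<le> M * norm (p - q)"
  obtains T z where "T > 0" "(z \<longlongrightarrow> Z0) (at_right 0)"
    "\<And>t. t \<in> {0<..<T} \<Longrightarrow> z t \<in> cball Z0 r \<and> distinct3 (z t)"
    "\<And>t. t \<in> {0<..<T} \<Longrightarrow>
       (z has_vector_derivative cscale (\<i> * of_real \<kappa>) (cnj3 (interaction (z t))) + E (z t)) (at t)"
proof -
  obtain \<rho> where \<rho>: "\<rho> > 0" "\<And>u. u \<in> cball 0 \<rho> \<Longrightarrow> config u \<in> noncollision"
    "\<And>u v. u \<in> cball 0 \<rho> \<Longrightarrow> v \<in> cball 0 \<rho> \<Longrightarrow> norm (shifted_field u - shifted_field v) \<le> 39 / 8 * norm (u - v)"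
    by (rule shifted_field_lipschitz) blast
  obtain K where K: "K > 0" "\<And>x. norm (positions_lin x) \<le> norm x * K"
    using bounded_linear.pos_bounded[OF bounded_linear_positions_lin] by blast
  obtain G where G: "G > 0" "\<And>x. norm (velocity_coords x) \<le> norm x * G"
    using bounded_linear.pos_bounded[OF bounded_linear_velocity_coords] by blast
  define V where "V = norm (positions 0) + \<rho> * K"
  have V: "V \<ge> 0" using \<rho>(1) K by (simp add: V_def)
  have posV: "norm (positions w) \<le> V" if "w \<in> cball 0 \<rho>" for w
  proof -
    have "norm (positions w - positions 0) \<le> norm w * K" using K(2)[of w] by (simp add: positions_diff)
    also have "\<dots> \<le> \<rho> * K" using that K by (intro mult_right_mono) auto
    finally show ?thesis using norm_triangle_sub[of "positions w" "positions 0"] by (simp add: V_def)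
  qed
  \<comment> \<open>Along the self-similar solution \<open>|d|\<^sup>2 = \<delta>\<^sup>2 t\<close>.\<close>
  define \<delta> where "\<delta> = sqrt (12 * \<kappa> / 5)"
  have \<delta>: "\<delta> > 0" "\<delta> * \<delta> = 12 * \<kappa> / 5" using \<open>\<kappa> > 0\<close> by (auto simp: \<delta>_def)
  define S0 where "S0 = r / (\<delta> * (V + 1))"
  have S0: "S0 > 0" using \<open>r > 0\<close> \<delta> V by (simp add: S0_def)
  define c where "c = (\<lambda>s. of_real \<delta> * (of_real s * spiral s))"
  define Z where "Z = (\<lambda>s w. Z0 + cscale (c s) (positions w))"
  \<comment> \<open>The factor 2 s of dt = 2 s ds, divided by the scale \<delta> s
    \<open>spiral s\<close>, leaves 2 / (\<delta> \<open>spiral s\<close>): the perturbation stays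
    bounded as s tends to 0.\<close>
  define P where "P = (\<lambda>s w. velocity_coords (cscale (of_real (2 / \<delta>) / spiral s) (E (Z s w))))"
  have Zr: "Z s w \<in> cball Z0 r" if "s \<in> {0<..S0}" "w \<in> cball 0 \<rho>" for s w
  proof -
    have "norm (cscale (c s) (positions w)) = \<delta> * s * norm (positions w)"
      using that \<delta> by (simp add: norm_cscale c_def norm_mult)
    also have "\<dots> \<le> \<delta> * S0 * (V + 1)"
      using that \<delta> V posV[OF that(2)] S0 by (intro mult_mono) auto
    also have "\<dots> = r" using \<delta> V by (simp add: S0_def)
    finally show ?thesis by (simp add: Z_def dist_norm)
  qed
  interpret cscale: bounded_bilinear cscale by (rule bounded_bilinear_cscale)
  interpret pinv: bounded_linear velocity_coords by (rule bounded_linear_velocity_coords)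
  interpret plin: bounded_linear positions_lin by (rule bounded_linear_positions_lin)
  have cZ0: "Z0 \<in> cball Z0 r" using \<open>r > 0\<close> by simp
  have PB: "norm (P s w) \<le> 2 / \<delta> * (norm (E Z0) + M * r) * G" if "s \<in> {0<..S0}" "w \<in> cball 0 \<rho>" for s w
  proof -
    have "norm (E (Z s w) - E Z0) \<le> M * norm (Z s w - Z0)" using EL Zr[OF that] cZ0 by blast
    also have "\<dots> \<le> M * r"
      using Zr[OF that] \<open>M \<ge> 0\<close> by (intro mult_left_mono) (auto simp: dist_norm norm_minus_commute)
    finally have "norm (E (Z s w)) \<le> norm (E Z0) + M * r"
      using norm_triangle_sub[of "E (Z s w)" "E Z0"] by linarith
    then have le: "norm (cscale (of_real (2 / \<delta>) / spiral s) (E (Z s w))) \<le> 2 / \<delta> * (norm (E Z0) + M * r)"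
      using \<delta>(1) by (simp add: norm_cscale norm_divide norm_mult divide_right_mono)
    show ?thesis unfolding P_def
      by (rule order_trans[OF G(2)], rule mult_right_mono[OF le less_imp_le[OF G(1)]])
  qed
  have PL: "norm (P s u - P s v) \<le> 2 / \<delta> * M * (\<delta> * S0 * K) * G * norm (u - v)"
    if s: "s \<in> {0<..S0}" and u: "u \<in> cball 0 \<rho>" and v: "v \<in> cball 0 \<rho>" for s u v
  proof -
    have "Z s u - Z s v = cscale (c s) (positions_lin (u - v))"
      by (simp add: Z_def positions_diff[symmetric] cscale.diff_right)
    then have "norm (Z s u - Z s v) = \<delta> * s * norm (positions_lin (u - v))"
      using s \<delta> by (simp add: norm_cscale c_def norm_mult)
    also have "\<dots> \<le> \<delta> * S0 * (norm (u - v) * K)"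
      using s \<delta> S0 K by (intro mult_mono) auto
    finally have "norm (E (Z s u) - E (Z s v)) \<le> M * (\<delta> * S0 * (norm (u - v) * K))"
      using EL[OF Zr[OF s u] Zr[OF s v]] \<open>M \<ge> 0\<close> by (meson order_trans mult_left_mono)
    then have "2 / \<delta> * norm (E (Z s u) - E (Z s v)) \<le> 2 / \<delta> * (M * (\<delta> * S0 * (norm (u - v) * K)))"
      using \<delta>(1) by (intro mult_left_mono) auto
    then have le: "norm (cscale (of_real (2 / \<delta>) / spiral s) (E (Z s u) - E (Z s v)))
        \<le> 2 / \<delta> * (M * (\<delta> * S0 * (norm (u - v) * K)))"
      using \<delta>(1) by (simp add: norm_cscale norm_divide norm_mult)
    have "P s u - P s v = velocity_coords (cscale (of_real (2 / \<delta>) / spiral s) (E (Z s u) - E (Z s v)))"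
      by (simp add: P_def pinv.diff cscale.diff_right)
    then have "norm (P s u - P s v) \<le> norm (cscale (of_real (2 / \<delta>) / spiral s) (E (Z s u) - E (Z s v))) * G"
      by (simp only: G(2))
    also have "\<dots> \<le> 2 / \<delta> * (M * (\<delta> * S0 * (norm (u - v) * K))) * G"
      using le G(1) by (intro mult_right_mono) auto
    finally have "norm (P s u - P s v) \<le> 2 / \<delta> * (M * (\<delta> * S0 * (norm (u - v) * K))) * G" .
    then show ?thesis using \<delta>(1) by (simp add: mult_ac)
  qed
  have spc: "continuous_on A spiral" if "A \<subseteq> {0<..}" for A
    unfolding spiral_def using that by (intro continuous_intros) auto
  have Zc: "continuous_on ({0<..S0} \<times> cball 0 \<rho>) (\<lambda>x. Z (fst x) (snd x))"
  proof -
    have "continuous_on UNIV positions"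
    proof (rule continuous_on_eq)
      show "continuous_on UNIV (\<lambda>x. positions_lin x + positions 0)"
        by (intro continuous_intros plin.continuous_on)
      show "positions_lin x + positions 0 = positions x" for x by (rule positions_eq)
    qed
    then have "continuous_on ({0<..S0} \<times> cball 0 \<rho>) (\<lambda>x. positions (snd x))"
      by (rule continuous_on_compose2) (auto intro!: continuous_intros)
    moreover have "continuous_on ({0<..S0} \<times> cball 0 \<rho>) (\<lambda>x. spiral (fst x))"
      by (rule continuous_on_compose2[OF spc[of "{0<..S0}"]]) (auto intro!: continuous_intros)
    ultimately show ?thesis unfolding Z_def c_def
      by (intro continuous_intros cscale.continuous_on)
  qed
  have "continuous_on (cball Z0 r) E"
    by (rule lipschitz_on_continuous_on[of M], rule lipschitz_onI)
       (use EL \<open>M \<ge> 0\<close> in \<open>auto simp: dist_norm\<close>)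
  then have Ec: "continuous_on ({0<..S0} \<times> cball 0 \<rho>) (\<lambda>x. E (Z (fst x) (snd x)))"
    by (rule continuous_on_compose2[OF _ Zc]) (use Zr in auto)
  have Pc: "continuous_on ({0<..S0} \<times> cball 0 \<rho>) (\<lambda>(s, w). P s w)"
  proof -
    have "continuous_on ({0<..S0} \<times> cball 0 \<rho>) (\<lambda>x. spiral (fst x))"
      by (rule continuous_on_compose2[OF spc[of "{0<..S0}"]]) (auto intro!: continuous_intros)
    then show ?thesis unfolding P_def case_prod_beta
      by (intro pinv.continuous_on cscale.continuous_on Ec continuous_intros) auto
  qed
  \<comment> \<open>The eigenvalues -1 \<plusminus> 3 i rule out n = 1 and n = 2, as |\<lambda> + n|
    < n + 1 fails there. For n = 4 the shifted spectrum 4, 2, 3 \<plusminus> 3 i leaves room for the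
    bound 39/8 < 5.\<close>
  obtain S w where S: "0 < S" "S \<le> S0" and w: "continuous_on {0..S} w" "w 0 = 0" "w ` {0..S} \<subseteq> cball 0 \<rho>"
    and w': "\<And>s. s \<in> {0<..<S} \<Longrightarrow>
       (w has_vector_derivative (1 / s) *\<^sub>R (shifted_field (w s) - real 4 *\<^sub>R w s) + P s (w s)) (at s)"
    by (rule singular_ode_solution[OF _ \<rho>(1) S0 _ _ shifted_field_0 \<rho>(3) Pc PB PL, of 4]) (auto simp: numeral_eq_Suc)
  have wr: "w s \<in> cball 0 \<rho>" if "s \<in> {0..S}" for s using w(3) that by blast
  define y where "y = (\<lambda>s. Z s (w s))"
  have y': "(y has_vector_derivative (2 * s) *\<^sub>R (cscale (\<i> * of_real \<kappa>) (cnj3 (interaction (y s))) + E (y s))) (at s)"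
    if s: "s \<in> {0<..<S}" for s
  proof -
    define v where "v = positions (w s)"
    define e where "e = E (y s)"
    have nc: "config (w s) \<in> noncollision" using \<rho>(2) wr s by auto
    have posv: "((\<lambda>s. positions (w s)) has_vector_derivative
        positions_lin ((1 / s) *\<^sub>R (shifted_field (w s) - 4 *\<^sub>R w s) + P s (w s))) (at s)"
    proof -
      have "((\<lambda>s. positions_lin (w s)) has_vector_derivative
        positions_lin ((1 / s) *\<^sub>R (shifted_field (w s) - real 4 *\<^sub>R w s) + P s (w s))) (at s)"
        by (rule plin.has_vector_derivative[OF w'[OF s]])
      from has_vector_derivative_add[OF this has_vector_derivative_const[of "positions 0"]]
      show ?thesis by (simp add: positions_eq)
    qed
    have eq: "positions_lin ((1 / s) *\<^sub>R (shifted_field (w s) - 4 *\<^sub>R w s) + P s (w s)) =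
       cscale (of_real (1 / s)) (cscale (- (1 + 3 * \<i>)) v + cscale (5 * \<i> / 6) (cnj3 (interaction v)))
         + cscale (of_real (2 / \<delta>) / spiral s) e"
      using positions_lin_field[OF nc]
      by (simp add: plin.add plin.scaleR P_def positions_lin_velocity_coords v_def e_def y_def)
         (simp add: scaleR_eq_cscale)
    have "(c has_vector_derivative of_real \<delta> * ((1 + 3 * \<i>) * spiral s)) (at s)"
      unfolding c_def using s by (intro has_vector_derivative_mult_right spiral_deriv) auto
    note cscale.has_vector_derivative[OF this posv, unfolded eq, folded v_def]
    then have "(y has_vector_derivative
        cscale (c s) (cscale (of_real (1 / s)) (cscale (- (1 + 3 * \<i>)) v + cscale (5 * \<i> / 6) (cnj3 (interaction v)))
         + cscale (of_real (2 / \<delta>) / spiral s) e)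
        + cscale (of_real \<delta> * ((1 + 3 * \<i>) * spiral s)) v) (at s)"
      unfolding y_def Z_def by (simp add: has_vector_derivative_add_const add.commute[of Z0])
    moreover have "cscale (c s) (cscale (of_real (1 / s)) (cscale (- (1 + 3 * \<i>)) v + cscale (5 * \<i> / 6) (cnj3 (interaction v)))
         + cscale (of_real (2 / \<delta>) / spiral s) e)
        + cscale (of_real \<delta> * ((1 + 3 * \<i>) * spiral s)) v
      = cscale (c s * of_real (1 / s) * (5 * \<i> / 6)) (cnj3 (interaction v)) + cscale (c s * (of_real (2 / \<delta>) / spiral s)) e
        + (cscale (of_real \<delta> * ((1 + 3 * \<i>) * spiral s)) v - cscale (c s * of_real (1 / s) * (1 + 3 * \<i>)) v)"
      by (simp only: cscale.add_right cscale.minus_left cscale.minus_right cscale_cscale mult_ac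
          diff_conv_add_uminus add_ac)
    \<comment> \<open>The first identity cancels the motion of the frame, the second leaves the
      factor 2 s on the image field. The third is where \<delta>^2 = 12 \<kappa> / 5 enters, through
      2 \<kappa> / \<delta>^2 = 5/6.\<close>
    moreover have "c s * of_real (1 / s) * (1 + 3 * \<i>) = of_real \<delta> * ((1 + 3 * \<i>) * spiral s)"
      "c s * (of_real (2 / \<delta>) / spiral s) = of_real (2 * s)"
      "c s * of_real (1 / s) * (5 * \<i> / 6) = of_real (2 * s) * (\<i> * of_real \<kappa> * cnj (1 / c s))"
    proof -
      have "1 / c s = of_real (1 / (\<delta> * s)) * (1 / spiral s)" by (simp add: c_def)
      then have "cnj (1 / c s) = of_real (1 / (\<delta> * s)) * spiral s"
        by (simp only: complex_cnj_mult cnj_spiral complex_cnj_complex_of_real)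
      then have ce: "cnj (1 / c s) = spiral s / of_real (\<delta> * s)" by simp
      have s0: "s \<noteq> 0" using s by simp
      show "c s * of_real (1 / s) * (1 + 3 * \<i>) = of_real \<delta> * ((1 + 3 * \<i>) * spiral s)"
        using s0 by (simp add: c_def)
      show "c s * (of_real (2 / \<delta>) / spiral s) = of_real (2 * s)"
        using s0 \<delta> by (simp add: c_def field_simps)
      have "complex_of_real \<kappa> = of_real (5 / 12 * (\<delta> * \<delta>))"
        by (rule arg_cong) (use \<delta>(2) in simp)
      then have "complex_of_real \<kappa> = 5 / 12 * of_real (\<delta> * \<delta>)" by simp
      then have "of_real (2 * s) * (\<i> * of_real \<kappa> * cnj (1 / c s))
          = of_real (2 * s) * (\<i> * (5 / 12 * of_real (\<delta> * \<delta>)) * (spiral s / of_real (\<delta> * s)))"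
        by (simp only: ce)
      also have "\<dots> = c s * of_real (1 / s) * (5 * \<i> / 6)"
        using s0 \<delta>(1) by (simp add: c_def field_simps)
      finally show "c s * of_real (1 / s) * (5 * \<i> / 6) = of_real (2 * s) * (\<i> * of_real \<kappa> * cnj (1 / c s))" ..
    qed
    moreover have "cnj3 (interaction (y s)) = cscale (cnj (1 / c s)) (cnj3 (interaction v))"
    proof -
      have "interaction (y s) = cscale (1 / c s) (interaction v)"
        unfolding y_def Z_def v_def by (rule interaction_cscale) (simp_all add: Z0_def)
      then show ?thesis by (simp add: cnj3_def cscale_def)
    qed
    ultimately show ?thesis by (simp add: scaleR_eq_cscale cscale.add_right e_def mult_ac)
  qed
  \<comment> \<open>Back in the time t the derivative 1 / (2 sqrt t) of the square root cancels the
    factor 2 s.\<close>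
  define z where "z = (\<lambda>t. y (sqrt t))"
  show ?thesis
  proof (rule that[of "S ^ 2" z])
    show "S ^ 2 > 0" using S by simp
    have rng: "sqrt t \<in> {0<..<S}" if "t \<in> {0<..<S ^ 2}" for t
      using that S by (auto intro: real_less_lsqrt)
    show "z t \<in> cball Z0 r \<and> distinct3 (z t)" if "t \<in> {0<..<S ^ 2}" for t
    proof
      have s: "sqrt t \<in> {0<..S0}" "sqrt t \<in> {0..S}" using rng[OF that] S by auto
      show "z t \<in> cball Z0 r" unfolding z_def y_def by (rule Zr[OF s(1) wr[OF s(2)]])
      have "distinct3 (positions (w (sqrt t)))" using positions_distinct \<rho>(2) wr[OF s(2)] by blast
      moreover have "c (sqrt t) \<noteq> 0" using s \<delta> by (simp add: c_def)
      ultimately show "distinct3 (z t)" unfolding z_def y_def Z_def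
        by (subst distinct3_cscale) (simp_all add: Z0_def)
    qed
    show "(z has_vector_derivative cscale (\<i> * of_real \<kappa>) (cnj3 (interaction (z t))) + E (z t)) (at t)"
      if t: "t \<in> {0<..<S ^ 2}" for t
    proof -
      have "(sqrt has_vector_derivative (1 / (2 * sqrt t))) (at t)"
        using t by (auto intro!: derivative_eq_intros simp: has_real_derivative_iff_has_vector_derivative[symmetric] field_simps)
      from vector_diff_chain_at[OF this y'[OF rng[OF t]]]
      show ?thesis using t by (simp add: o_def z_def)
    qed
    show "(z \<longlongrightarrow> Z0) (at_right 0)"
    proof -
      have "((\<lambda>t. \<delta> * sqrt t * V) \<longlongrightarrow> \<delta> * sqrt 0 * V) (at_right 0)"
        by (intro tendsto_intros)
      then have lim: "((\<lambda>t. \<delta> * sqrt t * V) \<longlongrightarrow> 0) (at_right 0)" by simp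
      have "\<forall>\<^sub>F t in at_right 0. norm (z t - Z0) \<le> \<delta> * sqrt t * V"
        unfolding eventually_at_right_field
      proof (intro exI conjI allI impI)
        show "0 < S ^ 2" using S by simp
        fix t assume "0 < t" "t < S ^ 2"
        then have t: "t \<in> {0<..<S ^ 2}" by simp
        then have "sqrt t \<in> {0..S}" using rng[OF t] by simp
        then show "norm (z t - Z0) \<le> \<delta> * sqrt t * V"
          using posV[OF wr] \<delta>(1) t
          by (simp add: z_def y_def Z_def norm_cscale c_def norm_mult mult_left_mono)
      qed
      from Lim_null_comparison[OF this lim] show ?thesis by (simp add: LIM_zero_iff)
    qed
  qed
qed

section \<open>Reflection and negative intensities\<close>

lemma cnj3_cnj3 [simp]: "cnj3 (cnj3 p) = p"
  by (simp add: cnj3_def)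

lemma norm_cnj3 [simp]: "norm (cnj3 p) = norm p"
proof -
  obtain x y z where "p = (x, y, z)" by (cases p)
  then show ?thesis by (simp add: cnj3_def norm_Pair)
qed

lemma bounded_linear_cnj3: "bounded_linear cnj3"
proof
  show "\<exists>K. \<forall>x. norm (cnj3 x) \<le> norm x * K" by (rule exI[of _ 1]) simp
qed (simp_all add: cnj3_def scaleR_prod_def scaleR_conv_of_real)

lemma interaction_cnj3: "interaction (cnj3 p) = cnj3 (interaction p)"
  by (simp add: interaction_def cnj3_def Let_def)

lemma cnj3_cscale: "cnj3 (cscale c p) = cscale (cnj c) (cnj3 p)"
  by (simp add: cscale_def cnj3_def)

lemma distinct3_cnj3 [simp]: "distinct3 (cnj3 p) \<longleftrightarrow> distinct3 p"
  by (simp add: distinct3_def cnj3_def)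

text \<open>The scale \<delta> needs \<kappa> > 0. Complex conjugation of all positions changes the
  sign of \<kappa> and conjugates \<open>E\<close>, which keeps its Lipschitz constant; for \<kappa>
  < 0 it is the mirror triangle that expands.\<close>

lemma vortex_burst:
  fixes E :: "triple \<Rightarrow> triple" and z\<^sub>0 :: complex and \<kappa> r M :: real
  defines "Z0 \<equiv> (z\<^sub>0, z\<^sub>0, z\<^sub>0)"
  assumes "\<kappa> \<noteq> 0" and r: "r > 0" and M: "M \<ge> 0"
    and EL: "\<And>p q. p \<in> cball Z0 r \<Longrightarrow> q \<in> cball Z0 r \<Longrightarrow> norm (E p - E q) \<le> M * norm (p - q)"
  obtains T z where "T > 0" "(z \<longlongrightarrow> Z0) (at_right 0)"
    "\<And>t. t \<in> {0<..<T} \<Longrightarrow> z t \<in> cball Z0 r \<and> distinct3 (z t)"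
    "\<And>t. t \<in> {0<..<T} \<Longrightarrow>
       (z has_vector_derivative cscale (\<i> * of_real \<kappa>) (cnj3 (interaction (z t))) + E (z t)) (at t)"
proof (cases "\<kappa> > 0")
  case True
  show ?thesis
    by (rule vortex_burst_pos[OF True r M EL[unfolded Z0_def]]) (auto simp: Z0_def intro: that)
next
  case False
  then have neg: "- \<kappa> > 0" using \<open>\<kappa> \<noteq> 0\<close> by simp
  interpret cnj3: bounded_linear cnj3 by (rule bounded_linear_cnj3)
  have c0: "cnj3 (cnj z\<^sub>0, cnj z\<^sub>0, cnj z\<^sub>0) = Z0" by (simp add: cnj3_def Z0_def)
  have cb: "cnj3 p \<in> cball Z0 r \<longleftrightarrow> p \<in> cball (cnj z\<^sub>0, cnj z\<^sub>0, cnj z\<^sub>0) r" for p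
  proof -
    have "dist Z0 (cnj3 p) = dist (cnj z\<^sub>0, cnj z\<^sub>0, cnj z\<^sub>0) p"
      unfolding c0[symmetric] dist_norm cnj3.diff[symmetric] by simp
    then show ?thesis by simp
  qed
  obtain T z where T: "T > 0" and lim: "(z \<longlongrightarrow> (cnj z\<^sub>0, cnj z\<^sub>0, cnj z\<^sub>0)) (at_right 0)"
    and dom: "\<And>t. t \<in> {0<..<T} \<Longrightarrow> z t \<in> cball (cnj z\<^sub>0, cnj z\<^sub>0, cnj z\<^sub>0) r \<and> distinct3 (z t)"
    and ode: "\<And>t. t \<in> {0<..<T} \<Longrightarrow>
       (z has_vector_derivative cscale (\<i> * of_real (- \<kappa>)) (cnj3 (interaction (z t))) + cnj3 (E (cnj3 (z t)))) (at t)"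
  proof (rule vortex_burst_pos[OF neg r M, of "cnj z\<^sub>0" "\<lambda>p. cnj3 (E (cnj3 p))"])
    fix p q assume "p \<in> cball (cnj z\<^sub>0, cnj z\<^sub>0, cnj z\<^sub>0) r" "q \<in> cball (cnj z\<^sub>0, cnj z\<^sub>0, cnj z\<^sub>0) r"
    then have "norm (E (cnj3 p) - E (cnj3 q)) \<le> M * norm (cnj3 p - cnj3 q)"
      by (intro EL) (simp_all only: cb)
    then show "norm (cnj3 (E (cnj3 p)) - cnj3 (E (cnj3 q))) \<le> M * norm (p - q)"
      by (simp flip: cnj3.diff)
  qed blast
  show ?thesis
  proof (rule that[of T "\<lambda>t. cnj3 (z t)"])
    show "T > 0" by fact
    show "((\<lambda>t. cnj3 (z t)) \<longlongrightarrow> Z0) (at_right 0)"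
      using cnj3.tendsto[OF lim] by (simp add: c0)
    fix t assume t: "t \<in> {0<..<T}"
    show "cnj3 (z t) \<in> cball Z0 r \<and> distinct3 (cnj3 (z t))"
      using dom[OF t] by (simp only: cb distinct3_cnj3)
    show "((\<lambda>t. cnj3 (z t)) has_vector_derivative
        cscale (\<i> * of_real \<kappa>) (cnj3 (interaction (cnj3 (z t)))) + E (cnj3 (z t))) (at t)"
      using cnj3.has_vector_derivative[OF ode[OF t]]
      by (simp add: cnj3.add cnj3_cscale interaction_cnj3)
  qed
qed

section \<open>The three-vortex system in the domain\<close>

definition vec3 :: "triple \<Rightarrow> complex ^ 3" where
  "vec3 p = vector [fst p, fst (snd p), snd (snd p)]"

lemma vec3_nth [simp]: "vec3 p $ 1 = fst p" "vec3 p $ 2 = fst (snd p)" "vec3 p $ 3 = snd (snd p)"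
  by (simp_all add: vec3_def)

lemma bounded_linear_vec3: "bounded_linear vec3"
  unfolding linear_conv_bounded_linear[symmetric]
  by (rule linearI) (simp_all add: vec_eq_iff forall_3)

lemma norm_triple_components:
  fixes p :: triple
  shows "norm (fst p) \<le> norm p" "norm (fst (snd p)) \<le> norm p" "norm (snd (snd p)) \<le> norm p"
  using norm_fst_le[of "fst p" "snd p"] norm_snd_le[of "snd p" "fst p"]
    norm_fst_le[of "fst (snd p)" "snd (snd p)"] norm_snd_le[of "snd (snd p)" "fst (snd p)"] by auto

lemma norm_vec3_nth: "norm (vec3 p $ j) \<le> norm p"
  using exhaust_3[of j] norm_triple_components[of p] by auto

lemma UNIV_3_diff: "UNIV - {1::3} = {2, 3}" "UNIV - {2::3} = {1, 3}" "UNIV - {3::3} = {1, 2}"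
  unfolding UNIV_3 by auto

context disc_map begin

text \<open>The equations prescribe conjugated velocities, hence the outer conjugate. The factor i /
  (2 pi) is that of \<open>cnj_perp_grad_gamma\<close>, with the minus sign of the boundary
  term.\<close>

definition image_force :: "real \<Rightarrow> triple \<Rightarrow> complex \<Rightarrow> complex" where
  "image_force \<xi> p x = cnj (- (\<i> * of_real \<xi> / (2 * pi)) *
     (- 1/3 * image_kernel x (fst p) + 2/3 * image_kernel x (fst (snd p)) + 2/3 * image_kernel x (snd (snd p))))"

definition image_field :: "real \<Rightarrow> triple \<Rightarrow> triple" where
  "image_field \<xi> p = (image_force \<xi> p (fst p), image_force \<xi> p (fst (snd p)), image_force \<xi> p (snd (snd p)))"

lemma image_field_lipschitz:
  assumes "z\<^sub>0 \<in> D"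
  obtains r M where "r > 0" "M \<ge> 0" "cball z\<^sub>0 r \<subseteq> D"
    "\<And>p q. p \<in> cball (z\<^sub>0, z\<^sub>0, z\<^sub>0) r \<Longrightarrow> q \<in> cball (z\<^sub>0, z\<^sub>0, z\<^sub>0) r \<Longrightarrow>
       norm (image_field \<xi> p - image_field \<xi> q) \<le> M * norm (p - q)"
proof -
  obtain r M where r: "r > 0" "M \<ge> 0" "cball z\<^sub>0 r \<subseteq> D"
    and M: "\<And>x y x' y'. x \<in> cball z\<^sub>0 r \<Longrightarrow> y \<in> cball z\<^sub>0 r \<Longrightarrow> x' \<in> cball z\<^sub>0 r \<Longrightarrow> y' \<in> cball z\<^sub>0 r \<Longrightarrow>
       norm (image_kernel x y - image_kernel x' y') \<le> M * (norm (x - x') + norm (y - y'))"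
    using image_kernel_lipschitz[OF assms] by blast
  \<comment> \<open>Both arguments of the kernel move, giving 2 M for each of the three kernels, and
    the absolute weights 1/3, 2/3, 2/3 add up to 5/3.\<close>
  define C where "C = \<bar>\<xi>\<bar> / (2 * pi) * (10/3 * M)"
  have C: "C \<ge> 0" using r by (simp add: C_def)
  note comp = norm_triple_components
  have in_ball: "fst p \<in> cball z\<^sub>0 r" "fst (snd p) \<in> cball z\<^sub>0 r" "snd (snd p) \<in> cball z\<^sub>0 r"
    if "p \<in> cball (z\<^sub>0, z\<^sub>0, z\<^sub>0) r" for p
    using that comp[of "(z\<^sub>0, z\<^sub>0, z\<^sub>0) - p"] by (auto simp: dist_norm)
  have force: "norm (image_force \<xi> p x - image_force \<xi> q y) \<le> C * norm (p - q)"
    if p: "p \<in> cball (z\<^sub>0, z\<^sub>0, z\<^sub>0) r" and q: "q \<in> cball (z\<^sub>0, z\<^sub>0, z\<^sub>0) r"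
      and x: "x \<in> cball z\<^sub>0 r" and y: "y \<in> cball z\<^sub>0 r" and xy: "norm (x - y) \<le> norm (p - q)" for p q x y
  proof -
    have P: "norm (image_kernel x a - image_kernel y b) \<le> 2 * M * norm (p - q)"
      if "a \<in> cball z\<^sub>0 r" "b \<in> cball z\<^sub>0 r" "norm (a - b) \<le> norm (p - q)" for a b
    proof -
      have "norm (image_kernel x a - image_kernel y b) \<le> M * (norm (x - y) + norm (a - b))"
        using M x y that by blast
      also have "\<dots> \<le> M * (norm (p - q) + norm (p - q))"
        using xy that r(2) by (intro mult_left_mono add_mono) auto
      finally show ?thesis by simp
    qed
    define P1 where "P1 = image_kernel x (fst p) - image_kernel y (fst q)"
    define P2 where "P2 = image_kernel x (fst (snd p)) - image_kernel y (fst (snd q))"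
    define P3 where "P3 = image_kernel x (snd (snd p)) - image_kernel y (snd (snd q))"
    have "norm P1 \<le> 2 * M * norm (p - q)" unfolding P1_def
      using comp(1)[of "p - q"] by (intro P in_ball p q) simp
    moreover have "norm P2 \<le> 2 * M * norm (p - q)" unfolding P2_def
      using comp(2)[of "p - q"] by (intro P in_ball p q) simp
    moreover have "norm P3 \<le> 2 * M * norm (p - q)" unfolding P3_def
      using comp(3)[of "p - q"] by (intro P in_ball p q) simp
    moreover have "norm (- 1/3 * P1 + 2/3 * P2 + 2/3 * P3) \<le> 1/3 * norm P1 + 2/3 * norm P2 + 2/3 * norm P3"
    proof -
      have "norm (- 1/3 * P1) = 1/3 * norm P1" "norm (2/3 * P2) = 2/3 * norm P2" "norm (2/3 * P3) = 2/3 * norm P3"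
        by (simp_all add: norm_mult norm_divide)
      then show ?thesis
        using norm_triangle_ineq[of "- 1/3 * P1 + 2/3 * P2" "2/3 * P3"]
          norm_triangle_ineq[of "- 1/3 * P1" "2/3 * P2"] by linarith
    qed
    ultimately have le: "norm (- 1/3 * P1 + 2/3 * P2 + 2/3 * P3) \<le> 10/3 * M * norm (p - q)"
      by linarith
    have "image_force \<xi> p x - image_force \<xi> q y =
        cnj (- (\<i> * of_real \<xi> / (2 * pi)) * (- 1/3 * P1 + 2/3 * P2 + 2/3 * P3))"
      unfolding image_force_def P1_def P2_def P3_def complex_cnj_diff[symmetric]
      by (simp only: ring_distribs) (simp add: algebra_simps)
    then have "norm (image_force \<xi> p x - image_force \<xi> q y) =
        \<bar>\<xi>\<bar> / (2 * pi) * norm (- 1/3 * P1 + 2/3 * P2 + 2/3 * P3)"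
      by (simp only: complex_mod_cnj norm_mult norm_minus_cancel norm_divide) simp
    also have "\<dots> \<le> \<bar>\<xi>\<bar> / (2 * pi) * (10/3 * M * norm (p - q))"
      using le by (intro mult_left_mono) auto
    finally show ?thesis by (simp add: C_def mult_ac)
  qed
  show ?thesis
  proof (rule that[of r "3 * C"])
    fix p q :: triple assume p: "p \<in> cball (z\<^sub>0, z\<^sub>0, z\<^sub>0) r" and q: "q \<in> cball (z\<^sub>0, z\<^sub>0, z\<^sub>0) r"
    have c: "norm (fst p - fst q) \<le> norm (p - q)" "norm (fst (snd p) - fst (snd q)) \<le> norm (p - q)"
      "norm (snd (snd p) - snd (snd q)) \<le> norm (p - q)"
      using comp[of "p - q"] by auto
    have triple: "norm (a, b, c) \<le> norm a + norm b + norm c" for a b c :: complex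
      using norm_Pair_le[of a "(b, c)"] norm_Pair_le[of b c] by linarith
    have "norm (image_field \<xi> p - image_field \<xi> q) \<le>
        norm (image_force \<xi> p (fst p) - image_force \<xi> q (fst q))
        + norm (image_force \<xi> p (fst (snd p)) - image_force \<xi> q (fst (snd q)))
        + norm (image_force \<xi> p (snd (snd p)) - image_force \<xi> q (snd (snd q)))"
      unfolding image_field_def diff_Pair by (rule triple)
    also have "\<dots> \<le> C * norm (p - q) + C * norm (p - q) + C * norm (p - q)"
      by (intro add_mono force p q in_ball c)
    finally show "norm (image_field \<xi> p - image_field \<xi> q) \<le> 3 * C * norm (p - q)" by simp
  qed (use r C in auto)
qed

text \<open>With distances and kernel values left abstract, one algebraic identity serves all three
  vortices; \<open>d1\<close> and \<open>d2\<close> are the normalised intensities, 2 or -1, of the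
  other two.\<close>

lemma vortex_rhs_component:
  fixes \<xi> d1 d2 :: real and P Q R X Y :: complex
  shows "1 / (2 * complex_of_real pi * \<i>) * (of_real (d1 / 3 * \<xi>) / X + of_real (d2 / 3 * \<xi>) / Y)
      - (of_real (- (1/3) * \<xi>) * (\<i> / (2 * pi) * P) + of_real (2/3 * \<xi>) * (\<i> / (2 * pi) * Q)
         + of_real (2/3 * \<xi>) * (\<i> / (2 * pi) * R))
    = cnj (\<i> * of_real (\<xi> / (6 * pi)) * cnj (of_real d1 / X + of_real d2 / Y)
       + cnj (- (\<i> * of_real \<xi> / (2 * pi)) * (- 1/3 * P + 2/3 * Q + 2/3 * R)))"
proof -
  have cnj: "cnj (\<i> * complex_of_real (\<xi> / (6 * pi)) * cnj w) = 1 / (2 * complex_of_real pi * \<i>) * (of_real (\<xi> / 3) * w)" for w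
    by (simp add: complex_eq_iff Re_divide Im_divide power2_eq_square field_simps)
  have force: "of_real (- (1/3) * \<xi>) * (\<i> / (2 * pi) * P) + of_real (2/3 * \<xi>) * (\<i> / (2 * pi) * Q)
         + of_real (2/3 * \<xi>) * (\<i> / (2 * pi) * R) = \<i> * of_real \<xi> / (2 * pi) * (- 1/3 * P + 2/3 * Q + 2/3 * R)"
    by (simp add: field_simps)
  have pair: "of_real (d1 / 3 * \<xi>) / X + of_real (d2 / 3 * \<xi>) / Y = of_real (\<xi> / 3) * (of_real d1 / X + of_real d2 / Y)"
    by (simp add: algebra_simps)
  show ?thesis
    unfolding force pair by (subst complex_cnj_add) (simp only: cnj complex_cnj_cnj minus_mult_left[symmetric] diff_conv_add_uminus)
qed

lemma vortex_rhs_eq: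
  assumes "\<And>j. vec3 p $ j \<in> D"
  shows "vortex_rhs D (vector [- (1/3) * \<xi>, 2/3 * \<xi>, 2/3 * \<xi>]) (vec3 p) j
    = vec3 (cnj3 (cscale (\<i> * of_real (\<xi> / (6 * pi))) (cnj3 (interaction p)) + image_field \<xi> p)) $ j"
proof -
  have pD: "fst p \<in> D" "fst (snd p) \<in> D" "snd (snd p) \<in> D"
    using assms[of 1] assms[of 2] assms[of 3] by simp_all
  note defs = vortex_rhs_def UNIV_3_diff sum_3 vector_3 cnj3_def cscale_def image_field_def image_force_def interaction_def Let_def
  have "\<forall>j. vortex_rhs D (vector [- (1/3) * \<xi>, 2/3 * \<xi>, 2/3 * \<xi>]) (vec3 p) j
    = vec3 (cnj3 (cscale (\<i> * of_real (\<xi> / (6 * pi))) (cnj3 (interaction p)) + image_field \<xi> p)) $ j"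
    unfolding forall_3
  proof (intro conjI)
    show "vortex_rhs D (vector [- (1/3) * \<xi>, 2/3 * \<xi>, 2/3 * \<xi>]) (vec3 p) 1
      = vec3 (cnj3 (cscale (\<i> * of_real (\<xi> / (6 * pi))) (cnj3 (interaction p)) + image_field \<xi> p)) $ 1"
      using vortex_rhs_component[where \<xi> = \<xi> and ?d1.0 = 2 and X = "fst p - fst (snd p)" and ?d2.0 = 2 and Y = "fst p - snd (snd p)"
        and P = "image_kernel (fst p) (fst p)" and Q = "image_kernel (fst p) (fst (snd p))" and R = "image_kernel (fst p) (snd (snd p))"]
      by (simp add: defs cnj_perp_grad_gamma pD)
    show "vortex_rhs D (vector [- (1/3) * \<xi>, 2/3 * \<xi>, 2/3 * \<xi>]) (vec3 p) 2
      = vec3 (cnj3 (cscale (\<i> * of_real (\<xi> / (6 * pi))) (cnj3 (interaction p)) + image_field \<xi> p)) $ 2"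
      using vortex_rhs_component[where \<xi> = \<xi> and ?d1.0 = "- 1" and X = "fst (snd p) - fst p" and ?d2.0 = 2 and Y = "fst (snd p) - snd (snd p)"
        and P = "image_kernel (fst (snd p)) (fst p)" and Q = "image_kernel (fst (snd p)) (fst (snd p))" and R = "image_kernel (fst (snd p)) (snd (snd p))"]
      by (simp add: defs cnj_perp_grad_gamma pD)
    show "vortex_rhs D (vector [- (1/3) * \<xi>, 2/3 * \<xi>, 2/3 * \<xi>]) (vec3 p) 3
      = vec3 (cnj3 (cscale (\<i> * of_real (\<xi> / (6 * pi))) (cnj3 (interaction p)) + image_field \<xi> p)) $ 3"
      using vortex_rhs_component[where \<xi> = \<xi> and ?d1.0 = "- 1" and X = "snd (snd p) - fst p" and ?d2.0 = 2 and Y = "snd (snd p) - fst (snd p)"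
        and P = "image_kernel (snd (snd p)) (fst p)" and Q = "image_kernel (snd (snd p)) (fst (snd p))" and R = "image_kernel (snd (snd p)) (snd (snd p))"]
      by (simp add: defs cnj_perp_grad_gamma pD)
  qed
  then show ?thesis by blast
qed

lemma vec3_cnj3: "vec3 (cnj3 p) $ j = cnj (vec3 p $ j)"
  using exhaust_3[of j] by (auto simp: cnj3_def)

lemma vec3_fat_diagonal: "distinct3 p \<Longrightarrow> vec3 p \<notin> fat_diagonal"
proof
  assume d: "distinct3 p" and "vec3 p \<in> fat_diagonal"
  then obtain j k where "j \<noteq> k" "vec3 p $ j = vec3 p $ k" by (auto simp: fat_diagonal_def)
  then show False
    using d exhaust_3[of j] exhaust_3[of k] by (auto simp: distinct3_def)
qed

lemma three_vortex_burst:
  assumes "\<xi> \<noteq> 0" and z0: "z\<^sub>0 \<in> D"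
  shows "\<exists>T>0. \<exists>z :: real \<Rightarrow> complex ^ 3.
           vortex_solution D (vector [- (1/3) * \<xi>, 2/3 * \<xi>, 2/3 * \<xi>]) T z \<and>
           (\<forall>j. ((\<lambda>t. z t $ j) \<longlongrightarrow> z\<^sub>0) (at_right 0))"
proof -
  let ?Z0 = "(z\<^sub>0, z\<^sub>0, z\<^sub>0)"
  obtain r M where r: "r > 0" "M \<ge> 0" "cball z\<^sub>0 r \<subseteq> D"
    and M: "\<And>p q. p \<in> cball ?Z0 r \<Longrightarrow> q \<in> cball ?Z0 r \<Longrightarrow>
       norm (image_field \<xi> p - image_field \<xi> q) \<le> M * norm (p - q)"
    using image_field_lipschitz[OF z0, of \<xi>] by blast
  have "\<xi> / (6 * pi) \<noteq> 0" using assms(1) by simp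
  then obtain T z where T: "T > 0" and lim: "(z \<longlongrightarrow> ?Z0) (at_right 0)"
    and dom: "\<And>t. t \<in> {0<..<T} \<Longrightarrow> z t \<in> cball ?Z0 r \<and> distinct3 (z t)"
    and ode: "\<And>t. t \<in> {0<..<T} \<Longrightarrow> (z has_vector_derivative
        cscale (\<i> * of_real (\<xi> / (6 * pi))) (cnj3 (interaction (z t))) + image_field \<xi> (z t)) (at t)"
    by (rule vortex_burst[OF _ r(1,2) M]) blast+
  interpret vec3: bounded_linear vec3 by (rule bounded_linear_vec3)
  interpret cnj3: bounded_linear cnj3 by (rule bounded_linear_cnj3)
  interpret cscale: bounded_bilinear cscale by (rule bounded_bilinear_cscale)
  define v where "v = (\<lambda>t. cscale (\<i> * of_real (\<xi> / (6 * pi))) (cnj3 (interaction (z t))) + image_field \<xi> (z t))"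
  have inD: "vec3 (z t) $ j \<in> D" if "t \<in> {0<..<T}" for t j
  proof -
    have b: "norm (?Z0 - z t) \<le> r" using dom[OF that] by (simp add: dist_norm)
    have "norm (vec3 (?Z0 - z t) $ j) \<le> norm (?Z0 - z t)"
      by (rule norm_vec3_nth)
    moreover have "vec3 (?Z0 - z t) $ j = z\<^sub>0 - vec3 (z t) $ j"
      using exhaust_3[of j] by auto
    ultimately have "vec3 (z t) $ j \<in> cball z\<^sub>0 r" using b by (simp add: dist_norm)
    then show ?thesis using r(3) by blast
  qed
  have zc: "continuous_on {0<..<T} z"
    using has_vector_derivative_continuous[OF ode] by (intro continuous_at_imp_continuous_on ballI)
  have "continuous_on (cball ?Z0 r) (image_field \<xi>)"
    by (rule lipschitz_on_continuous_on[of M], rule lipschitz_onI)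
       (use M r in \<open>auto simp: dist_norm\<close>)
  then have "continuous_on {0<..<T} (\<lambda>t. image_field \<xi> (z t))"
    by (rule continuous_on_compose2[OF _ zc]) (use dom in auto)
  moreover have "continuous_on {0<..<T} (\<lambda>t. interaction (z t))"
    unfolding interaction_def Let_def
    by (intro continuous_intros zc) (use dom in \<open>force simp: distinct3_def\<close>)+
  ultimately have vc: "continuous_on {0<..<T} (\<lambda>t. vec3 (v t))"
    unfolding v_def by (intro vec3.continuous_on continuous_on_add cscale.continuous_on cnj3.continuous_on continuous_on_const)
  have ode': "((\<lambda>t. vec3 (z t)) has_vector_derivative vec3 (v t)) (at t)" if "t \<in> {0<..<T}" for t
    unfolding v_def by (rule vec3.has_vector_derivative[OF ode[OF that]])
  show ?thesis
  proof (intro exI[of _ T] exI[of _ "\<lambda>t. vec3 (z t)"] conjI allI T)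
    show "((\<lambda>t. vec3 (z t) $ j) \<longlongrightarrow> z\<^sub>0) (at_right 0)" for j
    proof -
      have "((\<lambda>t. vec3 (z t) $ j) \<longlongrightarrow> vec3 ?Z0 $ j) (at_right 0)"
        by (intro tendsto_vec_nth vec3.tendsto lim)
      moreover have "vec3 ?Z0 $ j = z\<^sub>0" using exhaust_3[of j] by auto
      ultimately show ?thesis by simp
    qed
    show "vortex_solution D (vector [- (1/3) * \<xi>, 2/3 * \<xi>, 2/3 * \<xi>]) T (\<lambda>t. vec3 (z t))"
      unfolding vortex_solution_def
    proof (intro conjI ballI allI)
      show "(\<lambda>t. vec3 (z t)) C1_differentiable_on {0<..<T}"
        unfolding C1_differentiable_on_def
        by (intro exI[of _ "\<lambda>t. vec3 (v t)"] conjI ballI ode' vc)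
      fix t assume t: "t \<in> {0<..<T}"
      show "vec3 (z t) \<in> {w. \<forall>j. w $ j \<in> D} - fat_diagonal"
        using inD[OF t] vec3_fat_diagonal[of "z t"] dom[OF t] by simp
      fix j :: 3
      have "((\<lambda>s. cnj (vec3 (z s) $ j)) has_vector_derivative cnj (vec3 (v t) $ j)) (at t)"
        by (intro bounded_linear.has_vector_derivative[OF bounded_linear_cnj]
            bounded_linear.has_vector_derivative[OF bounded_linear_vec_nth] ode' t)
      moreover have "vortex_rhs D (vector [- (1/3) * \<xi>, 2/3 * \<xi>, 2/3 * \<xi>]) (vec3 (z t)) j = cnj (vec3 (v t) $ j)"
        unfolding vortex_rhs_eq[OF inD[OF t]] vec3_cnj3 v_def ..
      ultimately show "((\<lambda>s. cnj (vec3 (z s) $ j)) has_vector_derivative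
          vortex_rhs D (vector [- (1/3) * \<xi>, 2/3 * \<xi>, 2/3 * \<xi>]) (vec3 (z t)) j) (at t)" by simp
    qed
  qed
qed

end

theorem proposition2p16:
  fixes D :: "complex set" and \<xi> :: real and z\<^sub>0 :: complex
  assumes "open D" and "bounded D" and "connected D" and "simply_connected D"
    and "smooth_boundary D"
    and "\<xi> \<noteq> 0"
    and "z\<^sub>0 \<in> D"
  shows "\<exists>T>0. \<exists>z :: real \<Rightarrow> complex ^ 3.
           vortex_solution D (vector [- (1/3) * \<xi>, 2/3 * \<xi>, 2/3 * \<xi>]) T z \<and>
           (\<forall>j. ((\<lambda>t. z t $ j) \<longlongrightarrow> z\<^sub>0) (at_right 0))"
proof -
  have "D \<noteq> UNIV" using assms(2) not_bounded_UNIV by blast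
  then obtain f g where "f holomorphic_on D" "g holomorphic_on ball 0 1"
    "\<forall>z\<in>D. f z \<in> ball 0 1 \<and> g (f z) = z" "\<forall>z\<in>ball 0 1. g z \<in> D \<and> f (g z) = z"
    using Riemann_mapping_theorem[of D] assms(1,4,7) by blast
  then interpret disc_map D f g
    using assms by unfold_locales auto
  show ?thesis using assms(6,7) by (rule three_vortex_burst)
qed

end
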